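(* Let $0<p\le 1$ and let $X\in\mathbb{R}^{m\times n}$ with $\operatorname{rank}(X)=r\le d$. Then \[ \|X\|_{S_p}=\min_{U\in\mathbb{R}^{m\times d},\,V\in\mathbb{R}^{n\times d}:\,X=UV^{T}}\|U\|_{S_{2p}}\|V\|_{S_{2p}} =\min_{U\in\mathbb{R}^{m\times d},\,V\in\mathbb{R}^{n\times d}:\,X=UV^{T}}\left(\frac{\|U\|_{S_{2p}}^{2p}+\|V\|_{S_{2p}}^{2p}}{2}\right)^{1/p}, \] with both minima attained.
   Context: For $0<q<\infty$ and a real matrix $Y$ with singular values $\sigma_1(Y),\dots,\sigma_k(Y)$ ($k$ the smaller dimension of $Y$), the Schatten-$q$ (quasi-)norm is $\|Y\|_{S_q}=\left(\sum_{i=1}^{k}\sigma_i(Y)^q\right)^{1/q}$. *)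

theory Defs
  imports "Jordan_Normal_Form.Matrix" "Jordan_Normal_Form.Char_Poly" "Jordan_Normal_Form.DL_Rank"
    "HOL-Computational_Algebra.Polynomial"
begin

text \<open>Singular values of a real matrix Y (m x n): square roots of the eigenvalues
  (with multiplicity) of the positive semidefinite n x n matrix Y^T Y, i.e. of the
  roots of its characteristic polynomial (which splits over the reals).
  These are the min(m,n) singular values of Y together with max(0, n - m) extra zeros.\<close>
definition singular_values_mset :: "real mat \<Rightarrow> real multiset" where
  "singular_values_mset Y = image_mset sqrt (proots (char_poly (transpose_mat Y * Y)))"

text \<open>Schatten-q (quasi-)norm, 0 < q. Extra zeros contribute 0 since 0 powr q = 0.\<close>
definition schatten :: "real \<Rightarrow> real mat \<Rightarrow> real" where
  "schatten q Y = (sum_mset (image_mset (\<lambda>s. s powr q) (singular_values_mset Y))) powr (1 / q)"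

end

theory Submission
  imports
    "HOL-Analysis.Equivalence_Lebesgue_Henstock_Integration"
    "Jordan_Normal_Form.Schur_Decomposition"
    "Jordan_Normal_Form.Spectral_Radius"
    Defs
begin

unbundle no inner_syntax and no vec_syntax

text \<open>
  Everything reduces to one determinant inequality: if X = U V^T has singular values s_i, and
  u_j, v_j are the eigenvalues of U^T U and V^T V, then for all a, b > 0
  \<open>\<Prod>(1 + sqrt (a b) s\<^sub>i)\<^sup>2 \<le> \<Prod>(1 + a u\<^sub>j) * \<Prod>(1 + b v\<^sub>j)\<close>.
  It is a Cauchy-Schwarz inequality for determinants of the form det (1 + G^T H), applied in the
  singular bases of X, combined with the monotonicity of det on positive semidefinite matrices.
  For p < 1 the map \<open>x \<mapsto> x\<^sup>p\<close> is a constant multiple of the integral of ln (1 + t x) t^(-1-p)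
  over t > 0, so taking a = t c, b = t / c and integrating the logarithms gives
  \<open>2 \<Sum>s\<^sub>i\<^sup>p \<le> c\<^sup>p \<Sum>u\<^sub>j\<^sup>p + c\<^sup>-\<^sup>p \<Sum>v\<^sub>j\<^sup>p\<close>; optimising over c yields the product bound, the case
  p = 1 is a limit, and the second bound is AM-GM. No ordering of the singular values is needed.
\<close>

section \<open>The spectral theorem for real symmetric matrices\<close>

text \<open>The summand 1 in every determinant has two jobs. It keeps the Gram determinants at least
  1, hence nonzero, so a Schur complement can be formed for rank deficient factors; and it turns
  each zero eigenvalue into a factor 1, so that the n values attached to X can be compared with the
  d eigenvalues of \<open>U\<^sup>T * U\<close> and of \<open>V\<^sup>T * V\<close>. The obstacle in
  passing to singular bases is that X may be rectangular and rank deficient, so it does not supply n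
  orthonormal left singular vectors. They are replaced by a matrix A with zero columns where the
  singular value is zero; all that is required of A is that \<open>A * A\<^sup>T\<close> is a
  projection. The free parameter c reflects the invariance of \<open>U * V\<^sup>T\<close> under
  scaling U by sqrt c and V by 1 / sqrt c. The integral converges at infinity because p > 0 and at
  zero because p < 1; at p = 1 it diverges at zero, whence the limit. For attainment, the rank bound
  ensures that the nonzero singular values fit into d columns. One factorization serves both minima,
  because the product is sandwiched between the two quantities that it makes equal.\<close>

lemma real_symmetric_eigenvector_ex:
  fixes A :: "real mat"
  assumes A: "A \<in> carrier_mat n n" and sym: "A\<^sup>T = A" and n: "0 < n"
  obtains e v where "v \<in> carrier_vec n" "v \<noteq> 0\<^sub>v n" "A *\<^sub>v v = e \<cdot>\<^sub>v v"
proof -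
  let ?B = "map_mat complex_of_real A"
  have B: "?B \<in> carrier_mat n n" and symB: "?B\<^sup>T = ?B" using A sym by (auto simp: map_mat_transpose)
  from spectrum_non_empty[OF B n] obtain l where l: "eigenvalue ?B l" by (auto simp: spectrum_def)
  then obtain z where z: "z \<in> carrier_vec n" "z \<noteq> 0\<^sub>v n" "?B *\<^sub>v z = l \<cdot>\<^sub>v z"
    using B by (auto simp: eigenvalue_def eigenvector_def)
  have cz: "conjugate z \<in> carrier_vec n" using z by simp
  have "?B *\<^sub>v conjugate z = conjugate (?B *\<^sub>v z)"
    using A z(1) by (intro eq_vecI) (auto simp: scalar_prod_def cnj_sum)
  then have conj: "?B *\<^sub>v conjugate z = cnj l \<cdot>\<^sub>v conjugate z"
    using z by (auto simp: conjugate_smult_vec)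
  \<comment> \<open>Evaluating the Hermitian form of \<open>?B\<close> at z from both sides yields l
    and cnj l times the nonzero number \<open>z \<bullet>c z\<close>.\<close>
  have "l * (z \<bullet>c z) = (?B\<^sup>T *\<^sub>v z) \<bullet>c z" using z symB by simp
  also have "\<dots> = z \<bullet> (?B *\<^sub>v conjugate z)" by (rule transpose_vec_mult_scalar[OF B cz z(1)])
  also have "\<dots> = cnj l * (z \<bullet>c z)" unfolding conj using z by simp
  finally have "l = cnj l" using z conjugate_square_eq_0_vec[OF z(1)] by simp
  then have l_real: "l = complex_of_real (Re l)" by (simp add: complex_eq_iff)
  \<comment> \<open>z itself may be non-real. A real eigenvector is obtained instead from the real
    root \<open>Re l\<close> of the characteristic polynomial of A.\<close>
  have "poly (char_poly ?B) l = 0" using l eigenvalue_root_char_poly[OF B] by simp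
  then have "complex_of_real (poly (char_poly A) (Re l)) = 0"
    by (subst (asm) l_real) (simp add: of_real_hom.char_poly_hom[OF A])
  then have "eigenvalue A (Re l)" using eigenvalue_root_char_poly[OF A] by simp
  then show ?thesis using that A by (auto simp: eigenvalue_def eigenvector_def)
qed

lemma orthogonal_mat_first_col_ex:
  fixes v :: "real vec"
  assumes v: "v \<in> carrier_vec n" "v \<noteq> 0\<^sub>v n"
  obtains W c where "W \<in> carrier_mat n n" "W\<^sup>T * W = 1\<^sub>m n" "W * W\<^sup>T = 1\<^sub>m n" "col W 0 = c \<cdot>\<^sub>v v"
proof -
  interpret cof_vec_space n "TYPE(real)" .
  define b where "b = basis_completion v"
  define ws where "ws = gram_schmidt n b"
  note b = basis_completion[OF v, folded b_def]
  have n: "0 < n" using v by (cases n) auto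
  then obtain vs where bv: "b = v # vs" using b by (cases b) auto
  note ws = gram_schmidt_result[OF b(2,4,5) ws_def]
  have len: "length ws = n" using ws b by simp
  have hd: "ws ! 0 = v" using gram_schmidt_hd[OF v(1), of vs] len n
    unfolding ws_def bv by (metis hd_conv_nth length_greater_0_conv)
  have wsc: "ws ! i \<in> carrier_vec n" if "i < n" for i using ws(3) len that by (auto simp: subset_iff)
  have orth: "ws ! i \<bullet> ws ! j = 0 \<longleftrightarrow> i \<noteq> j" if "i < n" "j < n" for i j
    using corthogonalD[OF ws(2), of i j] that len by simp
  \<comment> \<open>\<open>gram_schmidt\<close> orthogonalises without normalising, so the columns
    still have to be divided by their lengths.\<close>
  define N where "N i = sqrt (ws ! i \<bullet> ws ! i)" for i
  have sq: "N i * N i = ws ! i \<bullet> ws ! i" for i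
    unfolding N_def by (simp add: scalar_prod_def sum_nonneg)
  define W where "W = Matrix.mat n n (\<lambda>(i, j). ws ! j $ i / N j)"
  have W: "W \<in> carrier_mat n n" by (simp add: W_def)
  have "W\<^sup>T * W = 1\<^sub>m n"
  proof (rule eq_matI)
    fix i j assume "i < dim_row (1\<^sub>m n)" "j < dim_col (1\<^sub>m n)"
    then have ij: "i < n" "j < n" by auto
    have "(W\<^sup>T * W) $$ (i, j) = (\<Sum>k<n. ws ! i $ k / N i * (ws ! j $ k / N j))"
      using ij by (auto simp: W_def scalar_prod_def lessThan_atLeast0)
    also have "\<dots> = (\<Sum>k<n. ws ! i $ k * ws ! j $ k) / (N i * N j)"
      by (simp add: sum_divide_distrib)
    also have "(\<Sum>k<n. ws ! i $ k * ws ! j $ k) = ws ! i \<bullet> ws ! j"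
      using wsc[OF ij(2)] by (simp add: scalar_prod_def lessThan_atLeast0)
    also have "\<dots> / (N i * N j) = (1\<^sub>m n) $$ (i, j)"
      using orth[OF ij] sq[of i] ij by auto
    finally show "(W\<^sup>T * W) $$ (i, j) = (1\<^sub>m n) $$ (i, j)" .
  qed (auto simp: W_def)
  moreover from this have "W * W\<^sup>T = 1\<^sub>m n" using W by (intro mat_mult_left_right_inverse[of "W\<^sup>T"]) auto
  moreover have "col W 0 = (1 / N 0) \<cdot>\<^sub>v v" using n v hd by (intro eq_vecI) (auto simp: W_def)
  ultimately show ?thesis using that W by blast
qed

lemma transpose_mult3:
  assumes "(A :: 'a :: comm_semiring_0 mat) \<in> carrier_mat a b" "B \<in> carrier_mat b c" "C \<in> carrier_mat c d"
  shows "(A * B * C)\<^sup>T = C\<^sup>T * B\<^sup>T * A\<^sup>T"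
  using assms by (subst transpose_mult[of _ a c _ d], auto simp: transpose_mult[of _ a b _ c])

lemma transpose_mat_diag[simp]: "(mat_diag n f)\<^sup>T = mat_diag n f"
  by (rule eq_matI) (auto simp: mat_diag_def)

lemma mult_diag_four_block_mat:
  fixes A :: "'a :: comm_ring_1 mat"
  assumes "A \<in> carrier_mat m m" "B \<in> carrier_mat n n" "C \<in> carrier_mat m m" "D \<in> carrier_mat n n"
  shows "four_block_mat A (0\<^sub>m m n) (0\<^sub>m n m) B * four_block_mat C (0\<^sub>m m n) (0\<^sub>m n m) D
    = four_block_mat (A * C) (0\<^sub>m m n) (0\<^sub>m n m) (B * D)"
  using assms by (subst mult_four_block_mat[of _ m m _ n _ n _ _ m _ n]) auto

text \<open>Deflation: in an orthonormal basis that starts with an eigenvector, the first column of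
  the matrix is a multiple of the first unit vector, and by symmetry so is the first row. The
  remaining block is symmetric of smaller size, and its diagonalizing matrix is extended by a
  leading 1.\<close>

theorem real_symmetric_diagonalization:
  fixes A :: "real mat"
  assumes "A \<in> carrier_mat n n" "A\<^sup>T = A"
  shows "\<exists>Q f. Q \<in> carrier_mat n n \<and> Q\<^sup>T * Q = 1\<^sub>m n \<and> Q * Q\<^sup>T = 1\<^sub>m n \<and> A = Q * mat_diag n f * Q\<^sup>T"
  using assms
proof (induction n arbitrary: A)
  case 0
  then show ?case by (intro exI[of _ "1\<^sub>m 0"] exI[of _ "\<lambda>_. 0"]) auto
next
  case (Suc n)
  note A = Suc.prems
  from real_symmetric_eigenvector_ex[OF A] obtain e v where
    v: "v \<in> carrier_vec (Suc n)" "v \<noteq> 0\<^sub>v (Suc n)" "A *\<^sub>v v = e \<cdot>\<^sub>v v" by blast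
  from orthogonal_mat_first_col_ex[OF v(1,2)] obtain W c where
    W: "W \<in> carrier_mat (Suc n) (Suc n)" "W\<^sup>T * W = 1\<^sub>m (Suc n)" "W * W\<^sup>T = 1\<^sub>m (Suc n)" "col W 0 = c \<cdot>\<^sub>v v"
    by blast
  define A' where "A' = W\<^sup>T * A * W"
  have A': "A' \<in> carrier_mat (Suc n) (Suc n)" using W A by (auto simp: A'_def)
  have symA': "A'\<^sup>T = A'" unfolding A'_def
    using W A by (subst transpose_mult3[of _ "Suc n" "Suc n" _ "Suc n" _ "Suc n"]) auto
  have AW: "A = W * A' * W\<^sup>T"
  proof -
    have "W * A' * W\<^sup>T = (W * W\<^sup>T) * A * (W * W\<^sup>T)"
      using W(1) A(1) by (simp add: A'_def assoc_mult_mat[where n\<^sub>1 = "Suc n" and n\<^sub>2 = "Suc n" and n\<^sub>3 = "Suc n" and n\<^sub>4 = "Suc n"])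
    then show ?thesis using W A by simp
  qed
  have "col A' 0 = W\<^sup>T *\<^sub>v (A *\<^sub>v col W 0)"
    using W A unfolding A'_def by (simp add: assoc_mult_mat[where n\<^sub>1 = "Suc n" and n\<^sub>2 = "Suc n" and n\<^sub>3 = "Suc n" and n\<^sub>4 = "Suc n"]
      col_mult2[where nr = "Suc n" and n = "Suc n" and nc = "Suc n"] del: col_mult)
  also have "A *\<^sub>v col W 0 = e \<cdot>\<^sub>v col W 0"
    unfolding W(4) using A v by (simp add: mult_mat_vec smult_smult_assoc mult.commute)
  also have "W\<^sup>T *\<^sub>v (e \<cdot>\<^sub>v col W 0) = e \<cdot>\<^sub>v col (W\<^sup>T * W) 0"
    using W(1) col_carrier_vec[OF _ W(1), of 0]
    by (simp add: mult_mat_vec[of "W\<^sup>T" "Suc n" "Suc n"] col_mult2[where nr = "Suc n" and n = "Suc n" and nc = "Suc n"] del: col_mult)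
  finally have col0: "col A' 0 = e \<cdot>\<^sub>v unit_vec (Suc n) 0" using W by simp
  have c0: "A' $$ (i, 0) = (if i = 0 then e else 0)" if "i < Suc n" for i
    using arg_cong[OF col0, of "\<lambda>v. v $ i"] that A' by auto
  have r0: "A' $$ (0, i) = (if i = 0 then e else 0)" if "i < Suc n" for i
    using c0[OF that] arg_cong[OF symA', of "\<lambda>M. M $$ (i, 0)"] that A' by auto
  define A3 where "A3 = Matrix.mat n n (\<lambda>(i, j). A' $$ (Suc i, Suc j))"
  have A3: "A3 \<in> carrier_mat n n" by (simp add: A3_def)
  have "A3\<^sup>T = A3"
  proof (rule eq_matI)
    fix i j assume "i < dim_row A3" "j < dim_col A3"
    then show "A3\<^sup>T $$ (i, j) = A3 $$ (i, j)"
      using arg_cong[OF symA', of "\<lambda>M. M $$ (Suc i, Suc j)"] A' by (auto simp: A3_def)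
  qed (auto simp: A3_def)
  from Suc.IH[OF A3 this] obtain P f where
    P: "P \<in> carrier_mat n n" "P\<^sup>T * P = 1\<^sub>m n" "P * P\<^sup>T = 1\<^sub>m n" "A3 = P * mat_diag n f * P\<^sup>T" by blast
  define P' where "P' = four_block_mat (1\<^sub>m 1) (0\<^sub>m 1 n) (0\<^sub>m n 1) P"
  define E where "E = Matrix.mat 1 1 (\<lambda>_. e)"
  define D where "D = four_block_mat E (0\<^sub>m 1 n) (0\<^sub>m n 1) (mat_diag n f)"
  have E: "E \<in> carrier_mat 1 1" by (simp add: E_def)
  have P': "P' \<in> carrier_mat (Suc n) (Suc n)" using P four_block_carrier_mat[of "1\<^sub>m 1" 1 1 P n n] by (simp add: P'_def)
  have tP': "P'\<^sup>T = four_block_mat (1\<^sub>m 1) (0\<^sub>m 1 n) (0\<^sub>m n 1) P\<^sup>T"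
    unfolding P'_def by (subst transpose_four_block_mat[of _ 1 1 _ n _ n]) (use P in auto)
  have D: "D = mat_diag (Suc n) (case_nat e f)"
    by (rule eq_matI) (auto simp: D_def E_def mat_diag_def split: nat.splits)
  have Dc: "D \<in> carrier_mat (Suc n) (Suc n)" unfolding D by simp
  have A'_block: "A' = four_block_mat E (0\<^sub>m 1 n) (0\<^sub>m n 1) A3"
  proof (rule eq_matI)
    fix i j assume "i < dim_row (four_block_mat E (0\<^sub>m 1 n) (0\<^sub>m n 1) A3)"
      "j < dim_col (four_block_mat E (0\<^sub>m 1 n) (0\<^sub>m n 1) A3)"
    then show "A' $$ (i, j) = four_block_mat E (0\<^sub>m 1 n) (0\<^sub>m n 1) A3 $$ (i, j)"
      using c0[of i] r0[of j] by (cases i; cases j) (auto simp: E_def A3_def)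
  qed (use A' in \<open>auto simp: E_def A3_def\<close>)
  have A'_P: "A' = P' * D * P'\<^sup>T"
    unfolding A'_block tP' unfolding P'_def D_def using P(1) E A3
    by (simp add: mult_diag_four_block_mat P(4) del: One_nat_def)
  have P'P': "P'\<^sup>T * P' = 1\<^sub>m (Suc n)"
    unfolding tP' unfolding P'_def using P(1,2)
    by (simp add: mult_diag_four_block_mat plus_1_eq_Suc del: One_nat_def)
  define Q where "Q = W * P'"
  have Q: "Q \<in> carrier_mat (Suc n) (Suc n)" using W P' by (simp add: Q_def)
  have tQ: "Q\<^sup>T = P'\<^sup>T * W\<^sup>T" unfolding Q_def by (rule transpose_mult[OF W(1) P'])
  note assoc = assoc_mult_mat[where n\<^sub>1 = "Suc n" and n\<^sub>2 = "Suc n" and n\<^sub>3 = "Suc n" and n\<^sub>4 = "Suc n"]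
  have "Q\<^sup>T * Q = P'\<^sup>T * (W\<^sup>T * W) * P'" unfolding tQ unfolding Q_def using W(1) P' by (simp add: assoc)
  then have QQ: "Q\<^sup>T * Q = 1\<^sub>m (Suc n)" using W P' P'P' by simp
  then have "Q * Q\<^sup>T = 1\<^sub>m (Suc n)" using Q by (intro mat_mult_left_right_inverse[of "Q\<^sup>T"]) auto
  moreover have "A = Q * mat_diag (Suc n) (case_nat e f) * Q\<^sup>T"
    unfolding tQ D[symmetric] unfolding AW A'_P Q_def using W(1) P' Dc by (simp add: assoc)
  ultimately show ?case using Q QQ by blast
qed

section \<open>Determinants of positive semidefinite matrices\<close>

text \<open>Over the reals a nonnegative quadratic form does not force symmetry, so symmetry is
  demanded explicitly; it also makes the matrix square.\<close>

definition psd :: "real mat \<Rightarrow> bool" where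
  "psd A \<longleftrightarrow> A\<^sup>T = A \<and> (\<forall>v \<in> carrier_vec (dim_row A). 0 \<le> v \<bullet> (A *\<^sub>v v))"

lemma psdI:
  assumes "A \<in> carrier_mat n n" "A\<^sup>T = A" "\<And>v. v \<in> carrier_vec n \<Longrightarrow> 0 \<le> v \<bullet> (A *\<^sub>v v)"
  shows "psd A"
  using assms by (auto simp: psd_def)

lemma psdD:
  assumes "psd A" "A \<in> carrier_mat n n"
  shows "A\<^sup>T = A" "\<And>v. v \<in> carrier_vec n \<Longrightarrow> 0 \<le> v \<bullet> (A *\<^sub>v v)"
  using assms by (auto simp: psd_def)

lemma scalar_prod_self_nonneg: "0 \<le> v \<bullet> (v :: real vec)"
  by (simp add: scalar_prod_def sum_nonneg)

lemma psd_congruence: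
  assumes B: "psd B" "B \<in> carrier_mat n n" and T: "T \<in> carrier_mat k n"
  shows "psd (T * B * T\<^sup>T)"
proof (rule psdI)
  show "T * B * T\<^sup>T \<in> carrier_mat k k" using B T by auto
  show "(T * B * T\<^sup>T)\<^sup>T = T * B * T\<^sup>T"
    using B T psdD(1)[OF B] by (subst transpose_mult3[OF T B(2)]) auto
  fix v :: "real vec" assume v: "v \<in> carrier_vec k"
  have Tv: "T\<^sup>T *\<^sub>v v \<in> carrier_vec n" using T v by simp
  have "v \<bullet> (T * B * T\<^sup>T *\<^sub>v v) = v \<bullet> (T *\<^sub>v (B *\<^sub>v (T\<^sup>T *\<^sub>v v)))"
    using T B v by (simp add: assoc_mult_mat_vec[of _ k n _ k] assoc_mult_mat_vec[of _ k n _ n])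
  also have "\<dots> = (T\<^sup>T *\<^sub>v v) \<bullet> (B *\<^sub>v (T\<^sup>T *\<^sub>v v))"
    using transpose_vec_mult_scalar[OF T _ v, of "B *\<^sub>v (T\<^sup>T *\<^sub>v v)"] B Tv by simp
  finally show "0 \<le> v \<bullet> (T * B * T\<^sup>T *\<^sub>v v)" using psdD(2)[OF B Tv] by simp
qed

lemma psd_one: "psd (1\<^sub>m n)"
  by (rule psdI[of _ n]) (auto intro: scalar_prod_self_nonneg)

lemma psd_mult_transpose: "psd (A * A\<^sup>T)"
proof -
  have "psd (A * 1\<^sub>m (dim_col A) * A\<^sup>T)" by (rule psd_congruence[OF psd_one]) auto
  then show ?thesis unfolding right_mult_one_mat'[OF refl] .
qed

lemma psd_transpose_mult: "psd (A\<^sup>T * A)"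
  using psd_mult_transpose[of "A\<^sup>T"] unfolding transpose_transpose .

lemma psd_add:
  assumes "psd A" "psd B" "A \<in> carrier_mat n n" "B \<in> carrier_mat n n"
  shows "psd (A + B)"
proof (rule psdI)
  fix v :: "real vec" assume v: "v \<in> carrier_vec n"
  have "v \<bullet> ((A + B) *\<^sub>v v) = v \<bullet> (A *\<^sub>v v) + v \<bullet> (B *\<^sub>v v)"
    using assms v by (simp add: add_mult_distrib_mat_vec[of _ n n] scalar_prod_add_distrib[of _ n])
  then show "0 \<le> v \<bullet> ((A + B) *\<^sub>v v)" using psdD(2)[of A n v] psdD(2)[of B n v] assms v by simp
next
  show "(A + B)\<^sup>T = A + B" using assms psdD(1)[of A n] psdD(1)[of B n] by (simp add: transpose_add[of _ n n])
qed (use assms in auto)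

lemma psd_diagonalization:
  assumes A: "psd A" "A \<in> carrier_mat n n"
  obtains Q f where "Q \<in> carrier_mat n n" "Q\<^sup>T * Q = 1\<^sub>m n" "Q * Q\<^sup>T = 1\<^sub>m n"
    "A = Q * mat_diag n f * Q\<^sup>T" "\<And>i. i < n \<Longrightarrow> 0 \<le> f i"
proof -
  from real_symmetric_diagonalization[OF A(2) psdD(1)[OF A]] obtain Q f where
    Q: "Q \<in> carrier_mat n n" "Q\<^sup>T * Q = 1\<^sub>m n" "Q * Q\<^sup>T = 1\<^sub>m n" "A = Q * mat_diag n f * Q\<^sup>T"
    by blast
  note assoc = assoc_mult_mat[where n\<^sub>1 = n and n\<^sub>2 = n and n\<^sub>3 = n and n\<^sub>4 = n]
  have "Q\<^sup>T * (Q * D * Q\<^sup>T) * Q = (Q\<^sup>T * Q) * D * (Q\<^sup>T * Q)" if "D \<in> carrier_mat n n" for D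
    using Q(1) that by (simp add: assoc)
  from this[of "mat_diag n f"] have "Q\<^sup>T * A * Q = (Q\<^sup>T * Q) * mat_diag n f * (Q\<^sup>T * Q)"
    unfolding Q(4) by simp
  then have D: "Q\<^sup>T * A * Q = mat_diag n f" using Q(2) right_mult_one_mat[of "mat_diag n f" n n] left_mult_one_mat[of "mat_diag n f" n n] by simp
  have "0 \<le> f i" if i: "i < n" for i
  proof -
    have Qi: "col Q i \<in> carrier_vec n" using Q(1) by auto
    \<comment> \<open>Each eigenvalue is the quadratic form of A at the corresponding unit
      eigenvector, hence nonnegative.\<close>
    have "f i = (Q\<^sup>T * A * Q) $$ (i, i)" using i by (simp add: D mat_diag_def)
    also have "\<dots> = (Q\<^sup>T * (A * Q)) $$ (i, i)" using Q(1) A(2) by (simp add: assoc)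
    also have "\<dots> = col Q i \<bullet> (A *\<^sub>v col Q i)"
      using Q(1) A(2) i by (simp add: col_mult2[OF A(2) Q(1)] del: col_mult)
    finally show ?thesis using psdD(2)[OF A Qi] by simp
  qed
  then show ?thesis using that Q by blast
qed

lemma det_mat_diag: "det (mat_diag n f) = (\<Prod>i<n. f i)"
proof -
  have "det (mat_diag n f) = prod_list (diag_mat (mat_diag n f))"
    by (rule det_upper_triangular[of _ n]) (auto simp: mat_diag_def)
  then show ?thesis by (simp add: prod_list_diag_prod mat_diag_def lessThan_atLeast0)
qed

lemma det_orthogonal_conj:
  assumes "Q \<in> carrier_mat n n" "Q * Q\<^sup>T = 1\<^sub>m n" "(B :: real mat) \<in> carrier_mat n n"
  shows "det (Q * B * Q\<^sup>T) = det B"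
proof -
  have "det Q * det (Q\<^sup>T) = 1" using assms det_mult[of Q n "Q\<^sup>T"] by simp
  then show ?thesis using assms by (simp add: det_mult[of _ n])
qed

lemma det_psd_nonneg:
  assumes "psd A" "A \<in> carrier_mat n n"
  shows "0 \<le> det A"
proof -
  from psd_diagonalization[OF assms] obtain Q f where
    "Q \<in> carrier_mat n n" "Q * Q\<^sup>T = 1\<^sub>m n" "A = Q * mat_diag n f * Q\<^sup>T" "\<And>i. i < n \<Longrightarrow> 0 \<le> f i" by blast
  then show ?thesis by (auto simp: det_orthogonal_conj det_mat_diag intro!: prod_nonneg)
qed

lemma one_add_orthogonal_conj:
  assumes "Q \<in> carrier_mat n n" "Q * Q\<^sup>T = 1\<^sub>m n" "(B :: real mat) \<in> carrier_mat n n"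
  shows "1\<^sub>m n + Q * B * Q\<^sup>T = Q * (1\<^sub>m n + B) * Q\<^sup>T"
proof -
  have "Q * (1\<^sub>m n + B) * Q\<^sup>T = (Q + Q * B) * Q\<^sup>T"
    using assms by (simp only: mult_add_distrib_mat[OF assms(1) one_carrier_mat assms(3)] right_mult_one_mat[OF assms(1)])
  also have "\<dots> = Q * Q\<^sup>T + Q * B * Q\<^sup>T" using assms by (intro add_mult_distrib_mat[of _ n n]) auto
  finally show ?thesis using assms(2) by simp
qed

lemma one_add_mat_diag: "(1\<^sub>m n :: real mat) + mat_diag n f = mat_diag n (\<lambda>i. 1 + f i)"
  by (rule eq_matI) (auto simp: mat_diag_def)

lemma det_one_add_psd_ge_1:
  assumes "psd A" "A \<in> carrier_mat n n"
  shows "1 \<le> det (1\<^sub>m n + A)"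
proof -
  from psd_diagonalization[OF assms] obtain Q f where
    Q: "Q \<in> carrier_mat n n" "Q * Q\<^sup>T = 1\<^sub>m n" "A = Q * mat_diag n f * Q\<^sup>T" "\<And>i. i < n \<Longrightarrow> 0 \<le> f i" by blast
  have "det (1\<^sub>m n + A) = (\<Prod>i<n. 1 + f i)"
    using Q(1,2) by (simp add: Q(3) one_add_orthogonal_conj one_add_mat_diag det_orthogonal_conj det_mat_diag)
  also have "\<dots> \<ge> 1" using Q(4) by (intro prod_ge_1) auto
  finally show ?thesis .
qed

lemma psd_factorization:
  assumes "psd A" "A \<in> carrier_mat n n"
  obtains S where "S \<in> carrier_mat n n" "A = S * S\<^sup>T"
proof -
  from psd_diagonalization[OF assms] obtain Q f where
    Q: "Q \<in> carrier_mat n n" "A = Q * mat_diag n f * Q\<^sup>T" "\<And>i. i < n \<Longrightarrow> 0 \<le> f i" by blast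
  define D where "D = mat_diag n (\<lambda>i. sqrt (f i))"
  define S where "S = Q * D"
  have D: "D \<in> carrier_mat n n" "D\<^sup>T = D" by (simp_all add: D_def)
  have "S * S\<^sup>T = Q * (D * D) * Q\<^sup>T"
    using Q(1) D by (simp add: S_def transpose_mult[of _ n n _ n] assoc_mult_mat[where n\<^sub>1 = n and n\<^sub>2 = n and n\<^sub>3 = n and n\<^sub>4 = n])
  also have "D * D = mat_diag n f"
    unfolding D_def mat_diag_diag using Q(3) by (intro eq_matI) (auto simp: mat_diag_def)
  finally show ?thesis using that[of S] Q D by (simp add: S_def)
qed

lemma invertible_if_det_nonzero:
  assumes "(A :: 'a :: field mat) \<in> carrier_mat n n" "det A \<noteq> 0"
  obtains B where "B \<in> carrier_mat n n" "A * B = 1\<^sub>m n" "B * A = 1\<^sub>m n"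
proof -
  have "A \<in> Units (ring_mat TYPE('a) n ())" by (rule det_non_zero_imp_unit[OF assms])
  then show ?thesis using that unfolding Units_def ring_mat_simps by blast
qed

text \<open>If A is singular, nonnegativity of the right side suffices. Otherwise A =
  \<open>S * S\<^sup>T\<close> with S invertible, and pulling S out reduces the claim to A = 1,
  where adding a positive semidefinite matrix raises every eigenvalue to at least 1.\<close>

lemma det_psd_mono:
  assumes A: "psd A" "A \<in> carrier_mat n n" and B: "psd B" "B \<in> carrier_mat n n"
  shows "det A \<le> det (A + B)"
proof (cases "det A = 0")
  case True
  then show ?thesis using det_psd_nonneg[OF psd_add[OF A(1) B(1) A(2) B(2)], of n] A B by simp
next
  case False
  from psd_factorization[OF A] obtain S where S: "S \<in> carrier_mat n n" "A = S * S\<^sup>T" by blast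
  then have detA: "det A = det S * det S" by (simp add: det_mult[of _ n] det_transpose[of _ n])
  with False obtain T where T: "T \<in> carrier_mat n n" "S * T = 1\<^sub>m n" "T * S = 1\<^sub>m n"
    using invertible_if_det_nonzero[OF S(1)] by auto
  define R where "R = T * B * T\<^sup>T"
  have R: "R \<in> carrier_mat n n" "psd R" using T B psd_congruence[OF B T(1)] by (auto simp: R_def)
  have tST: "T\<^sup>T * S\<^sup>T = 1\<^sub>m n" using transpose_mult[OF S(1) T(1)] T(2) by simp
  note assoc = assoc_mult_mat[where n\<^sub>1 = n and n\<^sub>2 = n and n\<^sub>3 = n and n\<^sub>4 = n]
  have "S * R * S\<^sup>T = (S * T) * B * (T\<^sup>T * S\<^sup>T)" using S(1) T(1) B(2) by (simp add: R_def assoc)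
  then have "A + B = S * (1\<^sub>m n + R) * S\<^sup>T"
    using S R B(2) by (simp add: mult_add_distrib_mat[of _ n n _ n] add_mult_distrib_mat[of _ n n _ _ n] T tST)
  then have "det (A + B) = det A * det (1\<^sub>m n + R)"
    using S(1) R(1) by (simp add: det_mult[of _ n] detA det_transpose[of _ n])
  moreover have "0 \<le> det A" using det_psd_nonneg[OF A] .
  ultimately show ?thesis using det_one_add_psd_ge_1[OF R(2,1)] mult_left_mono[of 1 "det (1\<^sub>m n + R)" "det A"] by simp
qed

section \<open>Determinant inequalities: Cauchy-Schwarz, Sylvester's identity, projections\<close>

text \<open>The hypothesis says that the block matrix with rows (K, -C^T) and (-C, L) is positive
  semidefinite; the proof compares L with the Schur complement term C K^-1 C^T.\<close>
lemma det_square_le_of_block_psd: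
  assumes K: "psd K" "K \<in> carrier_mat n n" "det K \<noteq> 0"
    and L: "L\<^sup>T = L" "L \<in> carrier_mat n n" and C: "C \<in> carrier_mat n n"
    and le: "\<And>v w. v \<in> carrier_vec n \<Longrightarrow> w \<in> carrier_vec n \<Longrightarrow>
      2 * (v \<bullet> (C *\<^sub>v w)) \<le> w \<bullet> (K *\<^sub>v w) + v \<bullet> (L *\<^sub>v v)"
  shows "(det C)\<^sup>2 \<le> det K * det L"
proof -
  from invertible_if_det_nonzero[OF K(2,3)] obtain J where
    J: "J \<in> carrier_mat n n" "K * J = 1\<^sub>m n" "J * K = 1\<^sub>m n" by blast
  note assoc = assoc_mult_mat[where n\<^sub>1 = n and n\<^sub>2 = n and n\<^sub>3 = n and n\<^sub>4 = n]
  have KJT: "K * J\<^sup>T = 1\<^sub>m n" using transpose_mult[OF J(1) K(2)] J(3) psdD(1)[OF K(1,2)] by simp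
  have "J\<^sup>T = (J * K) * J\<^sup>T" using J by simp
  also have "\<dots> = J * (K * J\<^sup>T)" using J(1) K(2) by (simp add: assoc)
  finally have JT: "J\<^sup>T = J" using J(1) KJT by simp
  have "J * K * J\<^sup>T = J" using J JT by simp
  then have psdJ: "psd J" using psd_congruence[OF K(1,2) J(1)] by simp
  define P where "P = C * J * C\<^sup>T"
  have P: "psd P" "P \<in> carrier_mat n n" using psd_congruence[OF psdJ J(1) C] C J by (auto simp: P_def)
  have LP: "L - P \<in> carrier_mat n n" using L P by (simp add: minus_carrier_mat)
  have "psd (L - P)"
  proof (rule psdI[OF LP])
    show "(L - P)\<^sup>T = L - P" using L P psdD(1)[OF P] by (simp add: transpose_minus[of _ n n])
    fix v :: "real vec" assume v: "v \<in> carrier_vec n"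
    define u where "u = C\<^sup>T *\<^sub>v v"
    \<comment> \<open>This w minimises \<open>w \<bullet> (K *\<^sub>v w) - 2 * (v \<bullet> (C
      *\<^sub>v w))\<close>. Both \<open>w \<bullet> (K *\<^sub>v w)\<close> and
      \<open>v \<bullet> (C *\<^sub>v w)\<close> become \<open>v \<bullet> (P *\<^sub>v v)\<close>,
      so the hypothesis collapses to P being below L.\<close>
    define w where "w = J *\<^sub>v u"
    have u: "u \<in> carrier_vec n" using C v by (simp add: u_def)
    have w: "w \<in> carrier_vec n" using J u by (simp add: w_def)
    have Cw: "C *\<^sub>v w = P *\<^sub>v v" using C J v u
      by (simp add: P_def w_def u_def assoc_mult_mat_vec[of _ n n _ n])
    have Kw: "K *\<^sub>v w = u" using K J u
      by (simp add: w_def assoc_mult_mat_vec[of _ n n _ n, symmetric])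
    have "w \<bullet> u = u \<bullet> w" by (rule comm_scalar_prod[OF w u])
    also have "u \<bullet> w = v \<bullet> (C *\<^sub>v w)" unfolding u_def by (rule transpose_vec_mult_scalar[OF C w v])
    finally have "w \<bullet> (K *\<^sub>v w) = v \<bullet> (P *\<^sub>v v)" by (simp add: Kw Cw)
    with le[OF v w] have "v \<bullet> (P *\<^sub>v v) \<le> v \<bullet> (L *\<^sub>v v)" by (simp add: Cw)
    then show "0 \<le> v \<bullet> ((L - P) *\<^sub>v v)" using L P v
      by (simp add: minus_mult_distrib_mat_vec[of _ n n] scalar_prod_minus_distrib[of _ n])
  qed
  then have "det P \<le> det (P + (L - P))" using P LP by (intro det_psd_mono) auto
  also have "P + (L - P) = L" using P L by (intro eq_matI) auto
  finally have le: "det P \<le> det L" .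
  have "det K * det J = 1" using det_mult[OF K(2) J(1)] J by simp
  then have "(det C)\<^sup>2 = det K * det P"
    using C J by (simp add: P_def det_mult[of _ n] det_transpose[of _ n] power2_eq_square)
  also have "\<dots> \<le> det K * det L" using le det_psd_nonneg[OF K(1,2)] by (intro mult_left_mono)
  finally show ?thesis .
qed

text \<open>Stacking the identity on top of G and of H makes the three matrices Gram products of the
  stacked ones. The bilinear form of the mixed one is a sum of two inner products, and
  \<open>2 * (x \<bullet> y) \<le> y \<bullet> y + x \<bullet> x\<close> applied to each gives the
  block hypothesis of \<open>det_square_le_of_block_psd\<close>.\<close>

lemma det_one_add_cauchy_schwarz:
  fixes G H :: "real mat"
  assumes G: "G \<in> carrier_mat d n" and H: "H \<in> carrier_mat d n"
  shows "(det (1\<^sub>m n + G\<^sup>T * H))\<^sup>2 \<le> det (1\<^sub>m n + G\<^sup>T * G) * det (1\<^sub>m n + H\<^sup>T * H)"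
proof -
  have form: "v \<bullet> ((1\<^sub>m n + A\<^sup>T * B) *\<^sub>v w) = v \<bullet> w + (A *\<^sub>v v) \<bullet> (B *\<^sub>v w)"
    if "A \<in> carrier_mat d n" "B \<in> carrier_mat d n" "v \<in> carrier_vec n" "w \<in> carrier_vec n"
    for A B :: "real mat" and v w
  proof -
    have "v \<bullet> (A\<^sup>T *\<^sub>v (B *\<^sub>v w)) = (A *\<^sub>v v) \<bullet> (B *\<^sub>v w)"
      using transpose_vec_mult_scalar[of "A\<^sup>T" n d "B *\<^sub>v w" v] that by simp
    then show ?thesis using that
      by (simp add: add_mult_distrib_mat_vec[of _ n n] scalar_prod_add_distrib[of _ n] assoc_mult_mat_vec[of _ n d _ n])
  qed
  have two: "2 * (x \<bullet> y) \<le> y \<bullet> y + x \<bullet> x" if "x \<in> carrier_vec k" "y \<in> carrier_vec k" for x y :: "real vec" and k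
  proof -
    have "0 \<le> (x - y) \<bullet> (x - y)" by (rule scalar_prod_self_nonneg)
    also have "\<dots> = x \<bullet> x - 2 * (x \<bullet> y) + y \<bullet> y"
      using that by (simp add: minus_scalar_prod_distrib[of _ k] scalar_prod_minus_distrib[of _ k] comm_scalar_prod[of y k x])
    finally show ?thesis by simp
  qed
  have psd: "psd (1\<^sub>m n + A\<^sup>T * A)" if "A \<in> carrier_mat d n" for A
    using that by (intro psd_add[of _ _ n] psd_one psd_transpose_mult) auto
  have "(det (1\<^sub>m n + G\<^sup>T * H))\<^sup>2 \<le> det (1\<^sub>m n + H\<^sup>T * H) * det (1\<^sub>m n + G\<^sup>T * G)"
  proof (rule det_square_le_of_block_psd)
    have "1 \<le> det (1\<^sub>m n + H\<^sup>T * H)" using H by (intro det_one_add_psd_ge_1 psd_transpose_mult) auto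
    then show "det (1\<^sub>m n + H\<^sup>T * H) \<noteq> 0" by simp
    show "(1\<^sub>m n + G\<^sup>T * G)\<^sup>T = 1\<^sub>m n + G\<^sup>T * G" using psdD(1)[OF psd[OF G], of n] G by simp
    fix v w :: "real vec" assume v: "v \<in> carrier_vec n" and w: "w \<in> carrier_vec n"
    have "G *\<^sub>v v \<in> carrier_vec d" "H *\<^sub>v w \<in> carrier_vec d" using G H v w by auto
    then show "2 * (v \<bullet> ((1\<^sub>m n + G\<^sup>T * H) *\<^sub>v w))
        \<le> w \<bullet> ((1\<^sub>m n + H\<^sup>T * H) *\<^sub>v w) + v \<bullet> ((1\<^sub>m n + G\<^sup>T * G) *\<^sub>v v)"
      unfolding form[OF G H v w] form[OF H H w w] form[OF G G v v]
      using two[OF v w] two[of "G *\<^sub>v v" d "H *\<^sub>v w"] by simp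
  qed (use psd G H in auto)
  then show ?thesis by (simp add: mult.commute)
qed

text \<open>The Weinstein-Aronszajn (Sylvester) identity: the block matrix B is eliminated in two
  ways, as \<open>E * F\<close> and as \<open>G * E\<close>, with block triangular factors whose
  determinants can be read off.\<close>

lemma det_one_add_mult_commute:
  fixes M N :: "'a :: idom mat"
  assumes M: "M \<in> carrier_mat n m" and N: "N \<in> carrier_mat m n"
  shows "det (1\<^sub>m n + M * N) = det (1\<^sub>m m + N * M)"
proof -
  define B where "B = four_block_mat (1\<^sub>m n) M (- N) (1\<^sub>m m)"
  define E where "E = four_block_mat (1\<^sub>m n) (0\<^sub>m n m) (- N) (1\<^sub>m m)"
  define F where "F = four_block_mat (1\<^sub>m n) M (0\<^sub>m m n) (1\<^sub>m m + N * M)"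
  define G where "G = four_block_mat (1\<^sub>m n + M * N) M (0\<^sub>m m n) (1\<^sub>m m)"
  have mN: "- N \<in> carrier_mat m n" using N by simp
  have car: "E \<in> carrier_mat (n + m) (n + m)" "F \<in> carrier_mat (n + m) (n + m)" "G \<in> carrier_mat (n + m) (n + m)"
    using M N by (auto simp: E_def F_def G_def)
  have "E * F = B"
    unfolding E_def F_def B_def using M N mN
    by (subst mult_four_block_mat[of _ n n _ m _ m _ _ n _ m])
       (auto intro!: cong_four_block_mat eq_matI)
  moreover have "G * E = B"
    unfolding E_def G_def B_def using M N mN
    by (subst mult_four_block_mat[of _ n n _ m _ m _ _ n _ m])
       (auto intro!: cong_four_block_mat eq_matI)
  ultimately have "det E * det F = det G * det E" using car by (simp add: det_mult[of _ "n + m", symmetric])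
  moreover have "det E = 1" unfolding E_def using mN
    by (subst det_four_block_mat_upper_right_zero[of _ n _ m]) auto
  moreover have "det F = det (1\<^sub>m m + N * M)" unfolding F_def using M N
    by (subst det_four_block_mat_lower_left_zero[of _ n _ m]) auto
  moreover have "det G = det (1\<^sub>m n + M * N)" unfolding G_def using M N
    by (subst det_four_block_mat_lower_left_zero[of _ n _ m]) auto
  ultimately show ?thesis by simp
qed

text \<open>\<open>P = A * A\<^sup>T\<close> is an orthogonal projection, and projecting the columns
  of U shrinks their Gram matrix by \<open>R\<^sup>T * R\<close>, where R is the part of U that P
  removes. Sylvester's identity first moves the determinant from size k to size d, where the two
  Gram matrices are comparable. Assuming idempotence instead of orthonormal columns admits an A with
  zero columns.\<close>

lemma det_one_add_gram_contraction:
  fixes A U :: "real mat"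
  assumes A: "A \<in> carrier_mat m k" and idem: "(A * A\<^sup>T) * (A * A\<^sup>T) = A * A\<^sup>T" and U: "U \<in> carrier_mat m d"
  shows "det (1\<^sub>m k + (U\<^sup>T * A)\<^sup>T * (U\<^sup>T * A)) \<le> det (1\<^sub>m d + U\<^sup>T * U)"
proof -
  define P where "P = A * A\<^sup>T"
  define R where "R = U - P * U"
  have P: "P \<in> carrier_mat m m" "P\<^sup>T = P" "P * P = P"
    using A idem by (auto simp: P_def transpose_mult[of _ m k _ m])
  have R: "R \<in> carrier_mat m d" using P U by (auto simp: R_def)
  have GG: "(U\<^sup>T * A) * (U\<^sup>T * A)\<^sup>T = U\<^sup>T * (P * U)"
    using A U by (simp add: P_def transpose_mult[of _ d m _ k] assoc_mult_mat[of _ d m _ k _ d] assoc_mult_mat[of _ m k _ m _ d])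
  have PU: "P * U \<in> carrier_mat m d" using P U by simp
  have "P * (P * U) = P * U" using assoc_mult_mat[of P m m P m U d] P U by simp
  then have PR: "P * R = 0\<^sub>m m d"
    using PU P U by (simp add: R_def mult_minus_distrib_mat[of _ m m])
  have "R\<^sup>T * (P * U) = (P * R)\<^sup>T * U"
    using P R U by (simp add: transpose_mult[of _ m m _ d] assoc_mult_mat[of _ d m _ m _ d])
  also have "\<dots> = 0\<^sub>m d d" using PR U by simp
  finally have RPU: "R\<^sup>T * (P * U) = 0\<^sub>m d d" .
  have "R\<^sup>T * R = R\<^sup>T * U - R\<^sup>T * (P * U)"
    using R U PU by (subst (2) R_def) (simp add: mult_minus_distrib_mat[of _ d m])
  also have "\<dots> = R\<^sup>T * U" unfolding RPU using R U by (intro eq_matI) auto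
  also have "\<dots> = U\<^sup>T * U - U\<^sup>T * (P * U)"
    using U P PU by (simp add: R_def transpose_minus[of _ m d] minus_mult_distrib_mat[of _ d m] transpose_mult[of _ m m _ d] assoc_mult_mat[of _ d m _ m _ d])
  finally have RR: "R\<^sup>T * R = U\<^sup>T * U - U\<^sup>T * (P * U)" .
  have "det (1\<^sub>m k + (U\<^sup>T * A)\<^sup>T * (U\<^sup>T * A)) = det (1\<^sub>m d + U\<^sup>T * (P * U))"
    using A U by (subst det_one_add_mult_commute[of _ k d]) (auto simp: GG)
  also have "\<dots> \<le> det (1\<^sub>m d + U\<^sup>T * (P * U) + R\<^sup>T * R)"
  proof (rule det_psd_mono[of _ d])
    show "psd (1\<^sub>m d + U\<^sup>T * (P * U))" unfolding GG[symmetric]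
      using A U by (intro psd_add[of _ _ d] psd_one psd_mult_transpose) auto
  qed (use psd_transpose_mult U P R in auto)
  also have "1\<^sub>m d + U\<^sup>T * (P * U) + R\<^sup>T * R = 1\<^sub>m d + U\<^sup>T * U"
    unfolding RR using U P by (intro eq_matI) auto
  finally show ?thesis .
qed

section \<open>From products to sums of powers\<close>

text \<open>With values in \<open>ennreal\<close>, scaling and additivity need no integrability;
  finiteness matters when the constant \<open>log_kernel p 1\<close> is cancelled.\<close>

definition log_kernel :: "real \<Rightarrow> real \<Rightarrow> ennreal" where
  "log_kernel p x = (\<integral>\<^sup>+t. ennreal (ln (1 + t * x) * t powr (- 1 - p)) * indicator {0<..} t \<partial>lborel)"

lemma log_kernel_scale:
  assumes "0 \<le> x" "0 < p"
  shows "log_kernel p x = ennreal (x powr p) * log_kernel p 1"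
proof (cases "x = 0")
  case True
  then show ?thesis by (simp add: log_kernel_def)
next
  case False
  with assms have x: "x > 0" by simp
  \<comment> \<open>Replacing t by t / x costs the Jacobian 1 / x and releases
    \<open>x powr (1 + p)\<close> from the weight; together they leave
    \<open>x powr p\<close>.\<close>
  have "log_kernel p x = ennreal \<bar>1 / x\<bar> * (\<integral>\<^sup>+t. ennreal (ln (1 + (0 + (1 / x) * t) * x) * (0 + (1 / x) * t) powr (- 1 - p))
       * indicator {0<..} (0 + (1 / x) * t) \<partial>lborel)"
    unfolding log_kernel_def using x by (intro nn_integral_real_affine) auto
  also have "(\<lambda>t. ennreal (ln (1 + (0 + (1 / x) * t) * x) * (0 + (1 / x) * t) powr (- 1 - p)) * indicator {0<..} (0 + (1 / x) * t))
     = (\<lambda>t. ennreal (x powr (1 + p)) * (ennreal (ln (1 + t * 1) * t powr (- 1 - p)) * indicator {0<..} t))"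
  proof
    fix t :: real
    show "ennreal (ln (1 + (0 + (1 / x) * t) * x) * (0 + (1 / x) * t) powr (- 1 - p)) * indicator {0<..} (0 + (1 / x) * t)
      = ennreal (x powr (1 + p)) * (ennreal (ln (1 + t * 1) * t powr (- 1 - p)) * indicator {0<..} t)"
    proof (cases "t > 0")
      case True
      have e: "(t / x) powr (- 1 - p) = x powr (1 + p) * t powr (- 1 - p)"
        using True x powr_minus_divide[of x "1 + p"] by (simp add: powr_divide)
      have "ln (1 + (0 + (1 / x) * t) * x) * (0 + (1 / x) * t) powr (- 1 - p)
        = x powr (1 + p) * (ln (1 + t * 1) * t powr (- 1 - p))"
        using x e by simp
      then show ?thesis using True x by (simp add: ennreal_mult[symmetric])
    next
      case False
      then have "(0 + (1 / x) * t) \<notin> {0<..}" "t \<notin> {0<..}" using x by (auto simp: zero_less_divide_iff)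
      then show ?thesis by (metis indicator_simps(2) mult_zero_right)
    qed
  qed
  also have "ennreal \<bar>1 / x\<bar> * (\<integral>\<^sup>+t. ennreal (x powr (1 + p)) * (ennreal (ln (1 + t * 1) * t powr (- 1 - p)) * indicator {0<..} t) \<partial>lborel)
    = ennreal \<bar>1 / x\<bar> * (ennreal (x powr (1 + p)) * log_kernel p 1)"
    unfolding log_kernel_def by (subst nn_integral_cmult) auto
  also have "\<dots> = ennreal (x powr p) * log_kernel p 1"
    using x by (simp add: mult.assoc[symmetric] ennreal_mult[symmetric] powr_add)
  finally show ?thesis .
qed

lemma log_kernel_pos: "0 < log_kernel p 1"
proof -
  \<comment> \<open>A lower bound for the integrand on [1, 2]: the logarithm is at least ln 2 there,
    and the power is monotone, so it is bounded below by its smaller endpoint value whatever the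
    sign of the exponent.\<close>
  define c where "c = ln 2 * min 1 (2 powr (- 1 - p))"
  have c: "c > 0" by (simp add: c_def)
  have "0 < ennreal c * emeasure lborel {1..2::real}" using c by (simp add: ennreal_zero_less_mult_iff)
  also have "\<dots> = (\<integral>\<^sup>+t. ennreal c * indicator {1..2::real} t \<partial>lborel)"
    by (simp add: nn_integral_cmult_indicator)
  also have "\<dots> \<le> log_kernel p 1" unfolding log_kernel_def
  proof (intro nn_integral_mono)
    fix t :: real
    show "ennreal c * indicator {1..2} t \<le> ennreal (ln (1 + t * 1) * t powr (- 1 - p)) * indicator {0<..} t"
    proof (cases "t \<in> {1..2}")
      case True
      have "min 1 (2 powr (- 1 - p)) \<le> t powr (- 1 - p)"
      proof (cases "- 1 - p \<ge> 0")
        case True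
        then show ?thesis using \<open>t \<in> {1..2}\<close> ge_one_powr_ge_zero[of t "-1-p"] by auto
      next
        case False
        then show ?thesis using \<open>t \<in> {1..2}\<close> powr_mono2'[of "-1-p" t 2] by auto
      qed
      then have "c \<le> ln (1 + t * 1) * t powr (- 1 - p)"
        using True unfolding c_def by (intro mult_mono) auto
      then show ?thesis using True by (auto intro: ennreal_leI)
    qed auto
  qed
  finally show ?thesis .
qed

text \<open>Near zero \<open>ln (1 + t) \<le> t\<close> leaves \<open>t powr (- p)\<close>,
  integrable since p < 1. Beyond 1 the logarithm is below a multiple of
  \<open>t powr (p / 2)\<close>, which uses up half of the decay and leaves an integrable tail. The
  constant C comes from \<open>ln_powr_bound\<close> at exponent p / 2 together with
  \<open>1 + t \<le> 2 * t\<close>.\<close>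

lemma log_kernel_finite:
  assumes p: "0 < p" "p < 1"
  shows "log_kernel p 1 < \<infinity>"
proof -
  define C where "C = 2 powr (p / 2) / (p / 2)"
  have C: "C \<ge> 0" using p by (simp add: C_def)
  have i1: "((\<lambda>t. t powr (- p)) has_integral (1 / (1 - p))) {0..1::real}"
    using has_integral_powr_from_0[of "-p" 1] p by simp
  have i2: "((\<lambda>t. C * t powr (- 1 - p / 2)) has_integral (C * (2 / p))) {1..}"
    using has_integral_mult_right[OF has_integral_powr_to_inf[of "-1-p/2" 1], of C] p by simp
  have n1: "(\<integral>\<^sup>+t. ennreal (t powr (- p)) * indicator {0..1} t \<partial>lborel) < \<infinity>"
    using nn_integral_has_integral_lebesgue[OF _ i1] by (simp add: nn_integral_completion nn_integral_set_ennreal mult.commute)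
  have "(\<integral>\<^sup>+t. ennreal (C * t powr (- 1 - p / 2)) * indicator {1..} t \<partial>lborel)
      = (\<integral>\<^sup>+t. ennreal (indicator {1..} t * (C * t powr (- 1 - p / 2))) \<partial>lborel)"
    by (intro nn_integral_cong) (auto split: split_indicator)
  then have n2: "(\<integral>\<^sup>+t. ennreal (C * t powr (- 1 - p / 2)) * indicator {1..} t \<partial>lborel) < \<infinity>"
    using nn_integral_has_integral_lebesgue[OF _ i2] C by (simp add: nn_integral_completion)
  have "log_kernel p 1 \<le> (\<integral>\<^sup>+t. ennreal (t powr (- p)) * indicator {0..1} t
      + ennreal (C * t powr (- 1 - p / 2)) * indicator {1..} t \<partial>lborel)"
    unfolding log_kernel_def
  proof (intro nn_integral_mono)
    fix t :: real
    let ?f = "ln (1 + t * 1) * t powr (- 1 - p)"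
    consider "t \<le> 0" | "0 < t" "t \<le> 1" | "t > 1" by linarith
    then show "ennreal ?f * indicator {0<..} t \<le> ennreal (t powr (- p)) * indicator {0..1} t
      + ennreal (C * t powr (- 1 - p / 2)) * indicator {1..} t"
    proof cases
      case 2
      have "?f \<le> t * t powr (- 1 - p)"
        using 2 by (intro mult_right_mono) (auto intro: ln_add_one_self_le_self)
      also have "t * t powr (- 1 - p) = t powr (- p)"
        using 2 powr_add[of t 1 "-1-p"] by simp
      finally have "ennreal ?f \<le> ennreal (t powr (- p))" by (rule ennreal_leI)
      then show ?thesis using 2 by (simp add: add_increasing2)
    next
      case 3
      have "ln (1 + t) \<le> (1 + t) powr (p / 2) / (p / 2)" using 3 p by (intro ln_powr_bound) auto
      also have "\<dots> \<le> (2 * t) powr (p / 2) / (p / 2)"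
        using 3 p by (intro divide_right_mono powr_mono2) auto
      also have "\<dots> = C * t powr (p / 2)" using 3 by (simp add: C_def powr_mult)
      finally have "?f \<le> C * t powr (p / 2) * t powr (- 1 - p)"
        by (intro mult_right_mono) auto
      also have "\<dots> = C * t powr (- 1 - p / 2)"
        unfolding mult.assoc by (subst powr_add[symmetric]) (simp add: algebra_simps)
      finally have "ennreal ?f \<le> ennreal (C * t powr (- 1 - p / 2))" by (rule ennreal_leI)
      then show ?thesis using 3 by auto
    qed auto
  qed
  also have "\<dots> = (\<integral>\<^sup>+t. ennreal (t powr (- p)) * indicator {0..1} t \<partial>lborel)
     + (\<integral>\<^sup>+t. ennreal (C * t powr (- 1 - p / 2)) * indicator {1..} t \<partial>lborel)"
    by (rule nn_integral_add) auto
  also have "\<dots> < \<infinity>" using n1 n2 by (simp add: ennreal_add_less_top)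
  finally show ?thesis .
qed

lemma prod_mset_one_add_ge_1:
  fixes M :: "real multiset"
  assumes "\<And>x. x \<in># M \<Longrightarrow> 0 \<le> x" "0 \<le> t"
  shows "1 \<le> (\<Prod>x\<in>#M. 1 + t * x)"
  using assms(1)
proof (induction M)
  case (add x M)
  then have "1 * 1 \<le> (1 + t * x) * (\<Prod>x\<in>#M. 1 + t * x)"
    using assms(2) by (intro mult_mono) auto
  then show ?case by simp
qed simp

lemma sum_mset_powr_nonneg: "0 \<le> (\<Sum>x\<in>#M. (x::real) powr p)"
  by (induction M) auto

lemma nn_integral_ln_prod:
  fixes M :: "real multiset"
  assumes "\<And>x. x \<in># M \<Longrightarrow> 0 \<le> x" "0 < p"
  shows "(\<integral>\<^sup>+t. ennreal (ln (\<Prod>x\<in>#M. 1 + t * x) * t powr (- 1 - p)) * indicator {0<..} t \<partial>lborel)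
    = ennreal (\<Sum>x\<in>#M. x powr p) * log_kernel p 1"
  using assms(1)
proof (induction M)
  case empty
  then show ?case by simp
next
  case (add x M)
  have [measurable]: "(\<lambda>t. \<Prod>x\<in>#N. 1 + t * x) \<in> borel_measurable borel" for N :: "real multiset"
    by (induction N) auto
  have "(\<integral>\<^sup>+t. ennreal (ln (\<Prod>x\<in>#add_mset x M. 1 + t * x) * t powr (- 1 - p)) * indicator {0<..} t \<partial>lborel)
    = (\<integral>\<^sup>+t. ennreal (ln (1 + t * x) * t powr (- 1 - p)) * indicator {0<..} t
        + ennreal (ln (\<Prod>x\<in>#M. 1 + t * x) * t powr (- 1 - p)) * indicator {0<..} t \<partial>lborel)"
  proof (intro nn_integral_cong)
    fix t :: real
    show "ennreal (ln (\<Prod>x\<in>#add_mset x M. 1 + t * x) * t powr (- 1 - p)) * indicator {0<..} t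
      = ennreal (ln (1 + t * x) * t powr (- 1 - p)) * indicator {0<..} t
        + ennreal (ln (\<Prod>x\<in>#M. 1 + t * x) * t powr (- 1 - p)) * indicator {0<..} t"
    proof (cases "t > 0")
      case True
      have "1 \<le> (\<Prod>x\<in>#M. 1 + t * x)" using True add.prems by (intro prod_mset_one_add_ge_1) auto
      moreover have "0 \<le> t * x" using True add.prems by simp
      ultimately have "ln (\<Prod>x\<in>#add_mset x M. 1 + t * x) * t powr (- 1 - p)
          = ln (1 + t * x) * t powr (- 1 - p) + ln (\<Prod>x\<in>#M. 1 + t * x) * t powr (- 1 - p)"
        using ln_mult_pos[of "1 + t * x" "\<Prod>x\<in>#M. 1 + t * x"] by (simp only: image_mset_add_mset prod_mset.add_mset distrib_right)
      then show ?thesis using True \<open>1 \<le> _\<close> \<open>0 \<le> t * x\<close> by simp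
    qed simp
  qed
  also have "\<dots> = log_kernel p x +
      (\<integral>\<^sup>+t. ennreal (ln (\<Prod>x\<in>#M. 1 + t * x) * t powr (- 1 - p)) * indicator {0<..} t \<partial>lborel)"
    unfolding log_kernel_def by (rule nn_integral_add) auto
  also have "\<dots> = ennreal (x powr p) * log_kernel p 1 + ennreal (\<Sum>x\<in>#M. x powr p) * log_kernel p 1"
    using add assms(2) log_kernel_scale[of x p] by simp
  also have "\<dots> = ennreal (\<Sum>x\<in>#add_mset x M. x powr p) * log_kernel p 1"
    by (simp add: distrib_right sum_mset_powr_nonneg)
  finally show ?case .
qed

lemma sum_powr_le_of_prod_le:
  fixes M N :: "real multiset"
  assumes M: "\<And>x. x \<in># M \<Longrightarrow> 0 \<le> x" and N: "\<And>x. x \<in># N \<Longrightarrow> 0 \<le> x"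
    and p: "0 < p" "p \<le> 1"
    and le: "\<And>t. 0 < t \<Longrightarrow> (\<Prod>x\<in>#M. 1 + t * x) \<le> (\<Prod>x\<in>#N. 1 + t * x)"
  shows "(\<Sum>x\<in>#M. x powr p) \<le> (\<Sum>x\<in>#N. x powr p)"
proof -
  have less_1: "(\<Sum>x\<in>#M. x powr q) \<le> (\<Sum>x\<in>#N. x powr q)" if q: "0 < q" "q < 1" for q
  proof -
    have eq: "ennreal (\<Sum>x\<in>#M. x powr q) * log_kernel q 1
        = (\<integral>\<^sup>+t. ennreal (ln (\<Prod>x\<in>#M. 1 + t * x) * t powr (- 1 - q)) * indicator {0<..} t \<partial>lborel)"
      "ennreal (\<Sum>x\<in>#N. x powr q) * log_kernel q 1
        = (\<integral>\<^sup>+t. ennreal (ln (\<Prod>x\<in>#N. 1 + t * x) * t powr (- 1 - q)) * indicator {0<..} t \<partial>lborel)"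
      using nn_integral_ln_prod[of M q] nn_integral_ln_prod[of N q] M N q by auto
    have "ennreal (\<Sum>x\<in>#M. x powr q) * log_kernel q 1 \<le> ennreal (\<Sum>x\<in>#N. x powr q) * log_kernel q 1"
      unfolding eq
    proof (intro nn_integral_mono)
      fix t :: real
      show "ennreal (ln (\<Prod>x\<in>#M. 1 + t * x) * t powr (- 1 - q)) * indicator {0<..} t
        \<le> ennreal (ln (\<Prod>x\<in>#N. 1 + t * x) * t powr (- 1 - q)) * indicator {0<..} t"
      proof (cases "t > 0")
        case True
        have "1 \<le> (\<Prod>x\<in>#M. 1 + t * x)" using True M by (intro prod_mset_one_add_ge_1) auto
        then have "ln (\<Prod>x\<in>#M. 1 + t * x) \<le> ln (\<Prod>x\<in>#N. 1 + t * x)"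
          using le[OF True] by (intro ln_mono) auto
        then show ?thesis using True by (auto intro!: ennreal_leI mult_right_mono)
      qed simp
    qed
    \<comment> \<open>Cancelling in \<open>ennreal\<close> requires the common factor to be neither
      0 nor infinite.\<close>
    then have "ennreal (\<Sum>x\<in>#M. x powr q) \<le> ennreal (\<Sum>x\<in>#N. x powr q)"
      using log_kernel_pos[of q] log_kernel_finite[OF q]
      by (metis ennreal_mult_le_mult_iff infinity_ennreal_def less_irrefl mult.commute)
    then show ?thesis by (simp add: ennreal_le_iff sum_mset_powr_nonneg)
  qed
  show ?thesis
  proof (cases "p < 1")
    case True
    then show ?thesis using less_1 p by blast
  next
    case False
    have lim: "((\<lambda>q. \<Sum>x\<in>#K. x powr q) \<longlongrightarrow> (\<Sum>x\<in>#K. x powr 1)) (at_left 1)"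
      if "\<And>x. x \<in># K \<Longrightarrow> 0 \<le> x" for K :: "real multiset"
      using that
    proof (induction K)
      case (add x K)
      \<comment> \<open>Continuity in the exponent also holds at x = 0, because the limiting
        exponent 1 is positive.\<close>
      have "((\<lambda>q. x powr q) \<longlongrightarrow> x powr 1) (at_left 1)"
        using add.prems by (intro tendsto_powr') (auto intro!: tendsto_intros)
      then show ?case using add by (auto intro!: tendsto_add)
    qed simp
    have "eventually (\<lambda>q. q \<in> {0<..<1::real}) (at_left 1)"
      by (rule eventually_at_left_real) simp
    then have "eventually (\<lambda>q. (\<Sum>x\<in>#M. x powr q) \<le> (\<Sum>x\<in>#N. x powr q)) (at_left 1)"
      by eventually_elim (use less_1 in auto)
    then have "(\<Sum>x\<in>#M. x powr 1) \<le> (\<Sum>x\<in>#N. x powr 1)"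
      by (intro tendsto_le[OF _ lim lim] M N) auto
    then show ?thesis using False p by simp
  qed
qed

text \<open>The infimum of the right-hand side over z is \<open>2 * sqrt (a * b)\<close>, attained
  at \<open>sqrt b / sqrt a\<close> when a and b are positive. If one of them vanishes, there is no
  such choice in general, and a large or small z is used to rule out S > 0.\<close>

lemma le_sqrt_mult_of_scaling:
  fixes S a b :: real
  assumes a: "0 \<le> a" and b: "0 \<le> b" and le: "\<And>z. 0 < z \<Longrightarrow> 2 * S \<le> z * a + b / z"
  shows "S \<le> sqrt a * sqrt b"
proof (cases "a = 0 \<or> b = 0")
  case True
  have "S \<le> 0"
  proof (rule ccontr)
    assume S: "\<not> S \<le> 0"
    show False
    proof (cases "a = 0")
      case True
      \<comment> \<open>The shift b + 1 covers b = 0 as well and pushes the bound below S,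
        contradicting 2 * S.\<close>
      have "2 * S \<le> b / ((b + 1) / S)" using le[of "(b + 1) / S"] S b True by auto
      also have "\<dots> = S * (b / (b + 1))" by simp
      also have "\<dots> \<le> S * 1" using S b by (intro mult_left_mono) auto
      finally show False using S by simp
    next
      case False
      have "2 * S \<le> S / (a + 1) * a" using le[of "S / (a + 1)"] S a \<open>a = 0 \<or> b = 0\<close> False by auto
      also have "\<dots> = S * (a / (a + 1))" by simp
      also have "\<dots> \<le> S * 1" using S a by (intro mult_left_mono) auto
      finally show False using S by simp
    qed
  qed
  then show ?thesis using a b by (smt (verit) mult_nonneg_nonneg real_sqrt_ge_zero)
next
  case False
  then have ab: "a > 0" "b > 0" using a b by auto
  have "2 * S \<le> sqrt b / sqrt a * a + b / (sqrt b / sqrt a)" using ab by (intro le) auto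
  also have "\<dots> = sqrt b * (a / sqrt a) + (b / sqrt b) * sqrt a" by simp
  also have "\<dots> = 2 * (sqrt a * sqrt b)" using ab by (simp add: real_div_sqrt)
  finally show ?thesis by simp
qed

lemma sum_powr_holder_of_prod_le:
  fixes S L M :: "real multiset"
  assumes S: "\<And>x. x \<in># S \<Longrightarrow> 0 \<le> x" and L: "\<And>x. x \<in># L \<Longrightarrow> 0 \<le> x" and M: "\<And>x. x \<in># M \<Longrightarrow> 0 \<le> x"
    and p: "0 < p" "p \<le> 1"
    and le: "\<And>a b. 0 < a \<Longrightarrow> 0 < b \<Longrightarrow>
      (\<Prod>x\<in>#S. 1 + sqrt (a * b) * x)\<^sup>2 \<le> (\<Prod>x\<in>#L. 1 + a * x) * (\<Prod>x\<in>#M. 1 + b * x)"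
  shows "(\<Sum>x\<in>#S. x powr p) \<le> sqrt (\<Sum>x\<in>#L. x powr p) * sqrt (\<Sum>x\<in>#M. x powr p)"
proof (rule le_sqrt_mult_of_scaling)
  fix z :: real assume z: "0 < z"
  define c where "c = z powr (1 / p)"
  have c: "c > 0" "c powr p = z" using z p by (auto simp: c_def powr_powr)
  have d: "(1 / c) powr p = 1 / z" using c by (simp add: powr_divide)
  have scale: "(\<Sum>x\<in>#image_mset ((*) d) K. x powr p) = d powr p * (\<Sum>x\<in>#K. x powr p)"
    if "0 < d" "\<And>x. x \<in># K \<Longrightarrow> 0 \<le> x" for d and K :: "real multiset"
    using that(2) by (induction K) (use that(1) in \<open>auto simp: powr_mult algebra_simps\<close>)
  \<comment> \<open>The square on the left becomes the doubled multiset S + S and the product on the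
    right a union of rescaled multisets, so that one application of
    \<open>sum_powr_le_of_prod_le\<close> suffices.\<close>
  have "(\<Sum>x\<in>#S + S. x powr p)
     \<le> (\<Sum>x\<in>#image_mset ((*) c) L + image_mset ((*) (1 / c)) M. x powr p)"
  proof (rule sum_powr_le_of_prod_le[OF _ _ p])
    fix t :: real assume t: "0 < t"
    have "sqrt (t * c * (t / c)) = t" using c t by (simp add: real_sqrt_mult)
    then show "(\<Prod>x\<in>#S + S. 1 + t * x) \<le> (\<Prod>x\<in>#image_mset ((*) c) L + image_mset ((*) (1 / c)) M. 1 + t * x)"
      using le[of "t * c" "t / c"] t c by (simp add: power2_eq_square image_mset.compositionality o_def mult.assoc)
  qed (use S L M c in auto)
  also have "\<dots> = c powr p * (\<Sum>x\<in>#L. x powr p) + (1 / c) powr p * (\<Sum>x\<in>#M. x powr p)"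
    using scale[of c L] scale[of "1 / c" M] c L M by auto
  finally show "2 * (\<Sum>x\<in>#S. x powr p) \<le> z * (\<Sum>x\<in>#L. x powr p) + (\<Sum>x\<in>#M. x powr p) / z"
    by (simp only: image_mset_union sum_mset.union mult_2 c d times_divide_eq_left mult_1_left)
qed (rule sum_mset_powr_nonneg)+

section \<open>Schatten quasi-norms of products\<close>

lemma proots_prod_linear_factors:
  "proots (\<Prod>a\<leftarrow>as. [:- a, 1:]) = mset (as :: 'a :: idom list)"
proof (induction as)
  case (Cons a as)
  have "(\<Prod>a\<leftarrow>as. [:- a, 1:]) \<noteq> 0" by (auto simp: prod_list_zero_iff)
  then have "proots ([:- a, 1:] * (\<Prod>a\<leftarrow>as. [:- a, 1:])) = proots [:- a, 1:] + mset as"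
    using Cons by (subst proots_mult) auto
  then show ?case by (simp only: list.map prod_list.Cons proots_linear_factor) simp
qed simp

lemma proots_char_poly_orthogonal_conj:
  fixes Q :: "real mat"
  assumes "Q \<in> carrier_mat n n" "Q\<^sup>T * Q = 1\<^sub>m n" "Q * Q\<^sup>T = 1\<^sub>m n"
  shows "proots (char_poly (Q * mat_diag n f * Q\<^sup>T)) = mset (map f [0..<n])"
proof -
  have "similar_mat (Q * mat_diag n f * Q\<^sup>T) (mat_diag n f)"
    using assms by (intro similar_matI[of _ _ Q "Q\<^sup>T" n]) auto
  moreover have "diag_mat (mat_diag n f) = map f [0..<n]" by (auto simp: diag_mat_def mat_diag_def)
  moreover have "char_poly (mat_diag n f) = (\<Prod>a\<leftarrow>diag_mat (mat_diag n f). [:- a, 1:])"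
    by (rule char_poly_upper_triangular[of _ n]) (auto simp: mat_diag_def)
  ultimately have "char_poly (Q * mat_diag n f * Q\<^sup>T) = (\<Prod>a\<leftarrow>map f [0..<n]. [:- a, 1:])"
    by (simp only: char_poly_similar)
  then show ?thesis by (simp only: proots_prod_linear_factors)
qed

lemma proots_char_poly_mat_diag: "proots (char_poly (mat_diag n f)) = mset (map (f :: nat \<Rightarrow> real) [0..<n])"
  using proots_char_poly_orthogonal_conj[of "1\<^sub>m n" n f] left_mult_one_mat[of "mat_diag n f" n n]
    right_mult_one_mat[of "mat_diag n f" n n] by simp

lemma proots_char_poly_psd_nonneg:
  assumes "psd B" "B \<in> carrier_mat n n" "x \<in># proots (char_poly B)"
  shows "0 \<le> x"
proof -
  from psd_diagonalization[OF assms(1,2)] obtain Q f where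
    Q: "Q \<in> carrier_mat n n" "Q\<^sup>T * Q = 1\<^sub>m n" "Q * Q\<^sup>T = 1\<^sub>m n" "B = Q * mat_diag n f * Q\<^sup>T" "\<And>i. i < n \<Longrightarrow> 0 \<le> f i"
    by blast
  then show ?thesis using assms(3) unfolding Q(4) proots_char_poly_orthogonal_conj[OF Q(1-3)] by auto
qed

text \<open>The bridge from matrix determinants to the scalar inequalities, which know a spectrum
  only as a multiset.\<close>

lemma det_one_add_smult_psd:
  assumes B: "psd B" "B \<in> carrier_mat n n"
  shows "det (1\<^sub>m n + a \<cdot>\<^sub>m B) = (\<Prod>x\<in>#proots (char_poly B). 1 + a * x)"
proof -
  from psd_diagonalization[OF assms] obtain Q f where
    Q: "Q \<in> carrier_mat n n" "Q\<^sup>T * Q = 1\<^sub>m n" "Q * Q\<^sup>T = 1\<^sub>m n" "B = Q * mat_diag n f * Q\<^sup>T" by blast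
  have "a \<cdot>\<^sub>m mat_diag n f = mat_diag n (\<lambda>i. a * f i)" by (rule eq_matI) (auto simp: mat_diag_def)
  moreover have "a \<cdot>\<^sub>m B = Q * (a \<cdot>\<^sub>m mat_diag n f) * Q\<^sup>T"
    unfolding Q(4) using Q(1) mult_smult_distrib[OF Q(1) mat_diag_dim, of a f]
      mult_smult_assoc_mat[of "Q * mat_diag n f" n n "Q\<^sup>T" n a] by (metis mat_diag_dim mult_carrier_mat transpose_carrier_mat)
  ultimately have "det (1\<^sub>m n + a \<cdot>\<^sub>m B) = (\<Prod>i<n. 1 + a * f i)"
    using Q(1,3) by (simp add: one_add_orthogonal_conj one_add_mat_diag det_orthogonal_conj det_mat_diag del: assoc_mult_mat)
  also have "\<dots> = (\<Prod>x\<in>#mset (map f [0..<n]). 1 + a * x)"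
    by (simp add: prod_unfold_prod_mset image_mset.compositionality o_def lessThan_atLeast0 mset_upt)
  finally show ?thesis unfolding Q(4) proots_char_poly_orthogonal_conj[OF Q(1-3)] .
qed

text \<open>The columns of \<open>X * Q\<close> are orthogonal with squared lengths f i, so dividing
  by s i normalises the nonzero ones. Since 1 / 0 = 0, the others become zero columns of A; no
  completion to an orthogonal matrix is made, and m < n is no special case. The formula for A in
  terms of X is exported because it shows that the columns of A lie in the column space of
  X.\<close>

lemma singular_value_decomposition:
  assumes X: "X \<in> carrier_mat m n"
  obtains A Q s where "Q \<in> carrier_mat n n" "Q\<^sup>T * Q = 1\<^sub>m n" "Q * Q\<^sup>T = 1\<^sub>m n"
    "\<And>i. i < n \<Longrightarrow> 0 \<le> s i" "singular_values_mset X = mset (map s [0..<n])"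
    "A = X * (Q * mat_diag n (\<lambda>i. 1 / s i))"
    "X = A * mat_diag n s * Q\<^sup>T" "A\<^sup>T * A = mat_diag n (\<lambda>i. if s i = 0 then 0 else 1)"
proof -
  have XX: "psd (X\<^sup>T * X)" "X\<^sup>T * X \<in> carrier_mat n n" using X psd_transpose_mult by auto
  from psd_diagonalization[OF XX] obtain Q f where
    Q: "Q \<in> carrier_mat n n" "Q\<^sup>T * Q = 1\<^sub>m n" "Q * Q\<^sup>T = 1\<^sub>m n" "X\<^sup>T * X = Q * mat_diag n f * Q\<^sup>T"
    and f: "\<And>i. i < n \<Longrightarrow> 0 \<le> f i" by blast
  define s where "s = (\<lambda>i. sqrt (f i))"
  define M where "M = X * Q"
  define S where "S = mat_diag n (\<lambda>i. 1 / s i)"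
  define A where "A = X * (Q * S)"
  have M: "M \<in> carrier_mat m n" using X Q by (simp add: M_def)
  have S: "S \<in> carrier_mat n n" by (simp add: S_def)
  have AM: "A = M * S" unfolding A_def M_def by (rule assoc_mult_mat[OF X Q(1) S, symmetric])
  note assoc = assoc_mult_mat[where n\<^sub>1 = n and n\<^sub>2 = n and n\<^sub>3 = n and n\<^sub>4 = n]
  have "M\<^sup>T * M = Q\<^sup>T * (X\<^sup>T * X) * Q"
    unfolding M_def using X Q(1) by (simp add: transpose_mult[of _ m n _ n] assoc_mult_mat[of _ n m _ n _ n]
      assoc_mult_mat[of _ n n _ m _ n] assoc_mult_mat[of _ n n _ n _ n])
  also have "\<dots> = (Q\<^sup>T * Q) * mat_diag n f * (Q\<^sup>T * Q)"
  proof -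
    have "Q\<^sup>T * (Q * D * Q\<^sup>T) * Q = (Q\<^sup>T * Q) * D * (Q\<^sup>T * Q)" if "D \<in> carrier_mat n n" for D
      using Q(1) that by (simp add: assoc)
    then show ?thesis unfolding Q(4) by simp
  qed
  finally have MM: "M\<^sup>T * M = mat_diag n f"
    using Q(2) right_mult_one_mat[of "mat_diag n f" n n] left_mult_one_mat[of "mat_diag n f" n n] by simp
  \<comment> \<open>A column of length zero vanishes, so dividing by s i and multiplying back
    recovers M even where s i = 0.\<close>
  have M0: "M $$ (k, i) = 0" if k: "k < m" and i: "i < n" and s: "s i = 0" for k i
  proof -
    have "(\<Sum>l<m. M $$ (l, i) * M $$ (l, i)) = (M\<^sup>T * M) $$ (i, i)"
      using M i by (simp add: scalar_prod_def lessThan_atLeast0)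
    also have "\<dots> = 0" using i s f[OF i] by (simp add: MM mat_diag_def s_def)
    finally have "M $$ (k, i) * M $$ (k, i) = 0"
      using k by (subst (asm) sum_nonneg_eq_0_iff) auto
    then show ?thesis by simp
  qed
  have "A * mat_diag n s = M"
    unfolding AM S_def mat_diag_mult_right[OF M] using M M0
    by (subst mat_diag_mult_right[of _ m]) (auto intro!: eq_matI)
  then have "A * mat_diag n s * Q\<^sup>T = X * (Q * Q\<^sup>T)"
    using X Q(1) by (simp add: M_def assoc_mult_mat[of _ m n _ n _ n])
  then have 1: "X = A * mat_diag n s * Q\<^sup>T" using Q(3) X by simp
  have "A\<^sup>T * A = S * (M\<^sup>T * M) * S"
    unfolding AM using M S by (simp add: transpose_mult[of _ m n _ n] S_def[symmetric]
      assoc_mult_mat[of _ n m _ n _ n] assoc_mult_mat[of _ n n _ m _ n] assoc_mult_mat[of _ n n _ n _ n])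
       (simp add: S_def)
  also have "\<dots> = mat_diag n (\<lambda>i. if s i = 0 then 0 else 1)"
    unfolding MM S_def mat_diag_diag using f
    by (intro eq_matI) (auto simp: mat_diag_def s_def divide_simps)
  finally have 2: "A\<^sup>T * A = mat_diag n (\<lambda>i. if s i = 0 then 0 else 1)" .
  have 3: "singular_values_mset X = mset (map s [0..<n])"
    unfolding singular_values_mset_def Q(4) proots_char_poly_orthogonal_conj[OF Q(1-3)]
    by (simp add: s_def image_mset.compositionality o_def)
  show ?thesis by (rule that[OF Q(1-3) _ 3 _ 1 2]) (use f in \<open>auto simp: s_def A_def S_def\<close>)
qed

text \<open>Expressed in the singular bases, \<open>G\<^sup>T * H\<close> is the diagonal matrix of
  the scaled singular values, so its determinant is the left-hand product. Cauchy-Schwarz separates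
  G from H, and the contraction lemma then removes A and Q.\<close>

lemma prod_singular_values_square_le:
  assumes U: "U \<in> carrier_mat m d" and V: "V \<in> carrier_mat n d" and X: "X = U * V\<^sup>T"
    and a: "0 < a" and b: "0 < b"
  shows "(\<Prod>x\<in>#singular_values_mset X. 1 + sqrt (a * b) * x)\<^sup>2
    \<le> (\<Prod>x\<in>#proots (char_poly (U\<^sup>T * U)). 1 + a * x) * (\<Prod>x\<in>#proots (char_poly (V\<^sup>T * V)). 1 + b * x)"
proof -
  have Xc: "X \<in> carrier_mat m n" using U V X by simp
  from singular_value_decomposition[OF Xc] obtain A Q s where
    Q: "Q \<in> carrier_mat n n" "Q\<^sup>T * Q = 1\<^sub>m n" "Q * Q\<^sup>T = 1\<^sub>m n"
    and s: "\<And>i. i < n \<Longrightarrow> 0 \<le> s i" "singular_values_mset X = mset (map s [0..<n])"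
    and A: "A = X * (Q * mat_diag n (\<lambda>i. 1 / s i))"
      "X = A * mat_diag n s * Q\<^sup>T" "A\<^sup>T * A = mat_diag n (\<lambda>i. if s i = 0 then 0 else 1)" by blast
  define S where "S = mat_diag n s"
  define E where "E = mat_diag n (\<lambda>i. if s i = 0 then 0 else 1 :: real)"
  define T where "T = mat_diag n (\<lambda>i. 1 / s i)"
  have ST: "S \<in> carrier_mat n n" "E \<in> carrier_mat n n" "T \<in> carrier_mat n n" by (simp_all add: S_def E_def T_def)
  have ES: "E * S = S" unfolding E_def S_def mat_diag_diag by (rule arg_cong[of _ _ "mat_diag n"]) auto
  have TE: "T * E = T" unfolding E_def T_def mat_diag_diag by (rule arg_cong[of _ _ "mat_diag n"]) auto
  have Ac: "A \<in> carrier_mat m n" using Xc Q(1) by (simp add: A(1))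
  have "A * E = X * (Q * (T * E))"
    unfolding A(1) T_def[symmetric] using Xc Q(1) ST by (simp add: assoc_mult_mat[of _ m n _ n _ n] assoc_mult_mat[of _ n n _ n _ n])
  \<comment> \<open>E erases only columns that are already zero. This is what makes
    \<open>A * A\<^sup>T\<close> idempotent although \<open>A\<^sup>T * A\<close> is E and not the
    identity.\<close>
  then have AE: "A * E = A" by (simp add: TE[unfolded T_def] A(1) T_def)
  have "(A * A\<^sup>T) * (A * A\<^sup>T) = A * (A\<^sup>T * A) * A\<^sup>T"
    using Ac by (simp add: assoc_mult_mat[of _ m n _ m _ m] assoc_mult_mat[of _ n m _ n _ m] assoc_mult_mat[of _ m n _ n _ m])
  also have "\<dots> = A * A\<^sup>T" unfolding A(3) E_def[symmetric] AE ..
  finally have idemA: "(A * A\<^sup>T) * (A * A\<^sup>T) = A * A\<^sup>T" .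
  have "A\<^sup>T * X * Q = (A\<^sup>T * A) * S * (Q\<^sup>T * Q)"
    unfolding A(2) S_def[symmetric] using Ac Q(1) ST
    by (simp add: assoc_mult_mat[of _ n m _ n _ n] assoc_mult_mat[of _ m n _ n _ n] assoc_mult_mat[of _ n n _ n _ n])
  then have AXQ: "A\<^sup>T * X * Q = S" using Q(2) ES ST unfolding A(3) E_def[symmetric] by simp
  define U' where "U' = sqrt a \<cdot>\<^sub>m U"
  define V' where "V' = sqrt b \<cdot>\<^sub>m V"
  have U': "U' \<in> carrier_mat m d" "V' \<in> carrier_mat n d" using U V by (auto simp: U'_def V'_def)
  have gram: "(sqrt c \<cdot>\<^sub>m W)\<^sup>T * (sqrt c \<cdot>\<^sub>m W) = c \<cdot>\<^sub>m (W\<^sup>T * W)" if "0 < c" for c and W :: "real mat"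
    using that by (intro eq_matI) (auto simp: scalar_prod_def sum_distrib_left algebra_simps intro!: sum.cong)
  define G where "G = U'\<^sup>T * A"
  define H where "H = V'\<^sup>T * Q"
  have GH: "G \<in> carrier_mat d n" "H \<in> carrier_mat d n" using U' Ac Q(1) by (auto simp: G_def H_def)
  have "U' * V'\<^sup>T = sqrt (a * b) \<cdot>\<^sub>m X"
    using U V unfolding X U'_def V'_def
    by (intro eq_matI) (auto simp: scalar_prod_def sum_distrib_left real_sqrt_mult algebra_simps intro!: sum.cong)
  moreover have "G\<^sup>T * H = A\<^sup>T * (U' * V'\<^sup>T) * Q"
    unfolding G_def H_def using U' Ac Q(1)
    by (simp add: transpose_mult[of _ d m _ n] assoc_mult_mat[of _ n m _ d _ n] assoc_mult_mat[of _ n m _ n _ n] assoc_mult_mat[of _ m d _ n _ n])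
  ultimately have "G\<^sup>T * H = sqrt (a * b) \<cdot>\<^sub>m (A\<^sup>T * X * Q)"
    using Ac Xc Q(1) mult_smult_distrib[of "A\<^sup>T" n m X n "sqrt (a * b)"]
      mult_smult_assoc_mat[of "A\<^sup>T * X" n n Q n "sqrt (a * b)"] by simp
  also have "\<dots> = mat_diag n (\<lambda>i. sqrt (a * b) * s i)"
    unfolding AXQ S_def by (rule eq_matI) (auto simp: mat_diag_def)
  finally have "det (1\<^sub>m n + G\<^sup>T * H) = (\<Prod>i<n. 1 + sqrt (a * b) * s i)"
    by (simp add: one_add_mat_diag det_mat_diag)
  also have "\<dots> = (\<Prod>x\<in>#singular_values_mset X. 1 + sqrt (a * b) * x)"
    unfolding s(2) by (simp add: prod_unfold_prod_mset image_mset.compositionality o_def lessThan_atLeast0 mset_upt)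
  finally have "(\<Prod>x\<in>#singular_values_mset X. 1 + sqrt (a * b) * x)\<^sup>2 = (det (1\<^sub>m n + G\<^sup>T * H))\<^sup>2" by simp
  also have "\<dots> \<le> det (1\<^sub>m n + G\<^sup>T * G) * det (1\<^sub>m n + H\<^sup>T * H)"
    by (rule det_one_add_cauchy_schwarz[OF GH])
  also have "\<dots> \<le> det (1\<^sub>m d + U'\<^sup>T * U') * det (1\<^sub>m d + V'\<^sup>T * V')"
  proof (rule mult_mono)
    show "det (1\<^sub>m n + G\<^sup>T * G) \<le> det (1\<^sub>m d + U'\<^sup>T * U')"
      unfolding G_def by (rule det_one_add_gram_contraction[OF Ac idemA U'(1)])
    show "det (1\<^sub>m n + H\<^sup>T * H) \<le> det (1\<^sub>m d + V'\<^sup>T * V')"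
      unfolding H_def by (rule det_one_add_gram_contraction[OF Q(1) _ U'(2)]) (simp add: Q(3))
    have "1 \<le> det (1\<^sub>m d + U'\<^sup>T * U')" using U' by (intro det_one_add_psd_ge_1 psd_transpose_mult) auto
    then show "0 \<le> det (1\<^sub>m d + U'\<^sup>T * U')" by simp
    have "1 \<le> det (1\<^sub>m n + H\<^sup>T * H)" using GH by (intro det_one_add_psd_ge_1 psd_transpose_mult) auto
    then show "0 \<le> det (1\<^sub>m n + H\<^sup>T * H)" by simp
  qed
  also have "\<dots> = (\<Prod>x\<in>#proots (char_poly (U\<^sup>T * U)). 1 + a * x) * (\<Prod>x\<in>#proots (char_poly (V\<^sup>T * V)). 1 + b * x)"
    unfolding U'_def V'_def gram[OF a] gram[OF b] using U V
    by (subst (1 2) det_one_add_smult_psd) (auto intro: psd_transpose_mult)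
  finally show ?thesis .
qed

text \<open>Singular values are square roots of Gram eigenvalues, so the exponent 2p on the factors
  becomes the exponent p of the scalar inequality.\<close>

lemma schatten_powr_eq:
  assumes "U \<in> carrier_mat m d" "0 < p"
  shows "schatten (2 * p) U powr (2 * p) = (\<Sum>x\<in>#proots (char_poly (U\<^sup>T * U)). x powr p)"
proof -
  have nonneg: "0 \<le> x" if "x \<in># proots (char_poly (U\<^sup>T * U))" for x
    using proots_char_poly_psd_nonneg[OF psd_transpose_mult, of U d x] that assms by auto
  have "(\<Sum>x\<in>#singular_values_mset U. x powr (2 * p)) = (\<Sum>x\<in>#proots (char_poly (U\<^sup>T * U)). x powr p)"
    unfolding singular_values_mset_def image_mset.compositionality o_def
  proof (intro arg_cong[of _ _ sum_mset] image_mset_cong)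
    fix x assume "x \<in># proots (char_poly (U\<^sup>T * U))"
    then show "sqrt x powr (2 * p) = x powr p" using nonneg by (simp add: powr_half_sqrt[symmetric] powr_powr)
  qed
  moreover have "schatten (2 * p) U powr (2 * p) = (\<Sum>x\<in>#singular_values_mset U. x powr (2 * p))"
    using assms(2) sum_mset_powr_nonneg by (simp add: schatten_def powr_powr)
  ultimately show ?thesis by simp
qed

lemma schatten_eq_powr: "0 < p \<Longrightarrow> schatten p X = (schatten p X powr p) powr (1 / p)"
  by (simp add: schatten_def powr_powr sum_mset_powr_nonneg)

text \<open>Writes the product as a geometric mean to the power 1 / p, parallel to the arithmetic
  mean in the second minimum.\<close>

lemma schatten_mult_eq_powr:
  assumes "0 < p"
  shows "schatten (2 * p) U * schatten (2 * p) V
    = sqrt (schatten (2 * p) U powr (2 * p) * schatten (2 * p) V powr (2 * p)) powr (1 / p)"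
proof -
  define a where "a = schatten (2 * p) U powr (2 * p)"
  define b where "b = schatten (2 * p) V powr (2 * p)"
  have ab: "0 \<le> a" "0 \<le> b" by (simp_all add: a_def b_def)
  have "schatten (2 * p) U * schatten (2 * p) V = a powr (1 / (2 * p)) * b powr (1 / (2 * p))"
    using schatten_eq_powr[of "2 * p" U] schatten_eq_powr[of "2 * p" V] assms by (simp add: a_def b_def)
  also have "\<dots> = sqrt (a * b) powr (1 / p)"
    using ab by (simp add: powr_mult powr_half_sqrt[symmetric] powr_powr)
  finally show ?thesis by (simp only: a_def b_def)
qed

theorem schatten_mult_le:
  assumes p: "0 < p" "p \<le> 1" and U: "U \<in> carrier_mat m d" and V: "V \<in> carrier_mat n d" and X: "X = U * V\<^sup>T"
  shows "schatten p X \<le> schatten (2 * p) U * schatten (2 * p) V"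
proof -
  have Xc: "X \<in> carrier_mat m n" using U V X by simp
  from singular_value_decomposition[OF Xc] obtain s where
    s: "\<And>i. i < n \<Longrightarrow> 0 \<le> s i" "singular_values_mset X = mset (map s [0..<n])" by metis
  have "(\<Sum>x\<in>#singular_values_mset X. x powr p)
    \<le> sqrt (\<Sum>x\<in>#proots (char_poly (U\<^sup>T * U)). x powr p) * sqrt (\<Sum>x\<in>#proots (char_poly (V\<^sup>T * V)). x powr p)"
  proof (rule sum_powr_holder_of_prod_le[OF _ _ _ p])
    show "0 \<le> x" if "x \<in># singular_values_mset X" for x using that s by auto
    show "0 \<le> x" if "x \<in># proots (char_poly (U\<^sup>T * U))" for x
      using proots_char_poly_psd_nonneg[OF psd_transpose_mult _ that, of d] U by auto
    show "0 \<le> x" if "x \<in># proots (char_poly (V\<^sup>T * V))" for x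
      using proots_char_poly_psd_nonneg[OF psd_transpose_mult _ that, of d] V by auto
  qed (rule prod_singular_values_square_le[OF U V X])
  also have "\<dots> = sqrt (schatten (2 * p) U powr (2 * p) * schatten (2 * p) V powr (2 * p))"
    unfolding schatten_powr_eq[OF U p(1)] schatten_powr_eq[OF V p(1)] real_sqrt_mult ..
  finally have "schatten p X \<le> sqrt (schatten (2 * p) U powr (2 * p) * schatten (2 * p) V powr (2 * p)) powr (1 / p)"
    unfolding schatten_def[of p X] using p by (intro powr_mono2) (auto simp: sum_mset_powr_nonneg)
  also have "\<dots> = schatten (2 * p) U * schatten (2 * p) V"
    by (rule schatten_mult_eq_powr[OF p(1), symmetric])
  finally show ?thesis .
qed

section \<open>Rank, nonzero singular values and an optimal factorization\<close>

lemma (in vec_space) rank_mult_le: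
  assumes A: "A \<in> carrier_mat n nc" and B: "B \<in> carrier_mat nc k"
  shows "rank (A * B) \<le> rank A"
proof -
  define W where "W = span (set (cols A))"
  have AB: "A * B \<in> carrier_mat n k" using A B by simp
  have sub: "set (cols (A * B)) \<subseteq> W"
  proof
    fix x assume "x \<in> set (cols (A * B))"
    then obtain j where j: "j < k" "x = col (A * B) j" using AB by (auto simp: cols_def)
    then have "x = A *\<^sub>v col B j" using col_mult2[OF A B] by simp
    then show "x \<in> W" using col_space_eq[OF A] A B j by (auto simp: W_def col_space_def)
  qed
  have sW: "subspace class_ring W V" unfolding W_def using A by (metis cols_dim carrier_matD(1) span_is_subspace)
  have sAB: "subspace class_ring (span (set (cols (A * B)))) V"
    using AB by (metis cols_dim carrier_matD(1) span_is_subspace)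
  have "span (set (cols (A * B))) \<subseteq> W"
    using sub sW by (simp add: span_is_subset subspace_def)
  then have "subspace class_ring (span (set (cols (A * B)))) (vs W)"
    by (rule nested_subspaces[OF sW sAB])
  then show ?thesis unfolding rank_def
    using vectorspace.subspace_dim[OF subspace_is_vs[OF sW]] fin_dim_span_cols[OF A] fin_dim_span_cols[OF AB]
    by (auto simp: W_def)
qed

lemma rank_of_orthonormal_cols:
  fixes N :: "real mat"
  assumes N: "N \<in> carrier_mat m k" and NN: "N\<^sup>T * N = 1\<^sub>m k"
  shows "vec_space.rank m N = k"
proof -
  interpret vec_space "TYPE(real)" m .
  have prod: "col N i \<bullet> col N j = (if i = j then 1 else 0)" if "i < k" "j < k" for i j
    using arg_cong[OF NN, of "\<lambda>M. M $$ (i, j)"] N that by auto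
  \<comment> \<open>Linear dependence is a property of the set of columns, so repeated columns have
    to be excluded separately.\<close>
  have dist: "distinct (cols N)"
    unfolding distinct_conv_nth
  proof (intro allI impI)
    fix i j assume "i < length (cols N)" "j < length (cols N)" "i \<noteq> j"
    then show "cols N ! i \<noteq> cols N ! j" using prod[of i i] prod[of i j] N by auto
  qed
  have "\<not> lin_dep (set (cols N))"
  proof
    assume "lin_dep (set (cols N))"
    from lin_depE[OF N this dist] obtain v where
      v: "v \<in> carrier_vec k" "v \<noteq> 0\<^sub>v k" "N *\<^sub>v v = 0\<^sub>v m" by blast
    have "v = (N\<^sup>T * N) *\<^sub>v v" using v NN by simp
    also have "\<dots> = N\<^sup>T *\<^sub>v (N *\<^sub>v v)" using N v by (simp add: assoc_mult_mat_vec[of _ k m _ k])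
    also have "\<dots> = 0\<^sub>v k" unfolding v(3) using N by (intro eq_vecI) auto
    finally show False using v by simp
  qed
  then show ?thesis by (rule lin_indpt_full_rank[OF N dist])
qed

text \<open>J selects the nonzero columns of A. They are orthonormal, so \<open>A * J\<close> has
  rank \<open>card I\<close>; being X times another matrix, it cannot exceed the rank of X.\<close>

lemma card_nonzero_singular_values_le_rank:
  assumes X: "X \<in> carrier_mat m n" and Q: "Q \<in> carrier_mat n n"
    and A: "A = X * (Q * mat_diag n (\<lambda>i. 1 / s i))"
    and AA: "A\<^sup>T * A = mat_diag n (\<lambda>i. if s i = 0 then 0 else 1)"
  shows "card {i. i < n \<and> s i \<noteq> (0::real)} \<le> vec_space.rank m X"
proof -
  define I where "I = {i. i < n \<and> s i \<noteq> 0}"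
  have "finite I" by (simp add: I_def)
  from ex_bij_betw_nat_finite[OF this] obtain h where h: "bij_betw h {0..<card I} I" by blast
  have hI: "h j < n" "s (h j) \<noteq> 0" if "j < card I" for j
    using bij_betwE[OF h] that by (auto simp: I_def)
  have hinj: "h i = h j \<longleftrightarrow> i = j" if "i < card I" "j < card I" for i j
    using bij_betw_imp_inj_on[OF h] that by (auto simp: inj_on_def)
  define J where "J = Matrix.mat n (card I) (\<lambda>(i, j). if h j = i then 1 else 0 :: real)"
  define B where "B = Q * mat_diag n (\<lambda>i. 1 / s i)"
  have J: "J \<in> carrier_mat n (card I)" by (simp add: J_def)
  have B: "B \<in> carrier_mat n n" using Q by (simp add: B_def)
  have Ac: "A \<in> carrier_mat m n" using X B by (simp add: A B_def)
  have "(A * J)\<^sup>T * (A * J) = J\<^sup>T * ((A\<^sup>T * A) * J)"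
    using Ac J by (simp add: transpose_mult[of _ m n _ "card I"] assoc_mult_mat[of _ "card I" n _ m _ "card I"]
        assoc_mult_mat[of _ n m _ n _ "card I"])
  also have "\<dots> = J\<^sup>T * J"
    unfolding AA mat_diag_mult_left[OF J]
    by (rule arg_cong[of _ _ "(*) (J\<^sup>T)"], rule eq_matI) (auto simp: J_def hI)
  also have "\<dots> = 1\<^sub>m (card I)"
  proof (rule eq_matI)
    fix i j assume "i < dim_row (1\<^sub>m (card I))" "j < dim_col (1\<^sub>m (card I))"
    then have ij: "i < card I" "j < card I" by auto
    have "(J\<^sup>T * J) $$ (i, j) = (\<Sum>l<n. (if h i = l then 1 else 0) * (if h j = l then 1 else 0))"
      using ij by (simp add: J_def scalar_prod_def lessThan_atLeast0)
    also have "\<dots> = (\<Sum>l<n. if l = h i then (if h j = h i then 1 else 0) else 0)"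
      by (intro sum.cong) auto
    also have "\<dots> = 1\<^sub>m (card I) $$ (i, j)" using ij hI[OF ij(1)] hinj[OF ij] by auto
    finally show "(J\<^sup>T * J) $$ (i, j) = 1\<^sub>m (card I) $$ (i, j)" .
  qed (auto simp: J_def)
  finally have "vec_space.rank m (A * J) = card I"
    using Ac J by (intro rank_of_orthonormal_cols) auto
  moreover have "A * J = X * (B * J)"
    using X B J by (simp add: A B_def[symmetric] assoc_mult_mat[of _ m n _ n _ "card I"])
  moreover have "vec_space.rank m (X * (B * J)) \<le> vec_space.rank m X"
    using X B J by (intro vec_space.rank_mult_le) auto
  ultimately show ?thesis by (simp add: I_def)
qed

text \<open>Split the singular values evenly: from X = A diag(s) Q^T put U = A diag(sqrt s) and
  V = Q diag(sqrt s), keeping the columns with nonzero s and padding with zero columns.\<close>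
lemma balanced_factorization:
  assumes X: "X \<in> carrier_mat m n" and rank: "vec_space.rank m X \<le> d"
  obtains U V where "U \<in> carrier_mat m d" "V \<in> carrier_mat n d" "X = U * V\<^sup>T"
    "(\<Sum>x\<in>#proots (char_poly (U\<^sup>T * U)). x powr p) = (\<Sum>x\<in>#singular_values_mset X. x powr p)"
    "(\<Sum>x\<in>#proots (char_poly (V\<^sup>T * V)). x powr p) = (\<Sum>x\<in>#singular_values_mset X. x powr p)"
proof -
  from singular_value_decomposition[OF X] obtain A Q s where
    Q: "Q \<in> carrier_mat n n" "Q\<^sup>T * Q = 1\<^sub>m n" "Q * Q\<^sup>T = 1\<^sub>m n"
    and s: "\<And>i. i < n \<Longrightarrow> 0 \<le> s i" "singular_values_mset X = mset (map s [0..<n])"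
    and A: "A = X * (Q * mat_diag n (\<lambda>i. 1 / s i))"
      "X = A * mat_diag n s * Q\<^sup>T" "A\<^sup>T * A = mat_diag n (\<lambda>i. if s i = 0 then 0 else 1)" by blast
  have Ac: "A \<in> carrier_mat m n" using X Q(1) by (simp add: A(1))
  define I where "I = {i. i < n \<and> s i \<noteq> 0}"
  define k where "k = card I"
  have k: "k \<le> d" using card_nonzero_singular_values_le_rank[OF X Q(1) A(1,3)] rank by (simp add: k_def I_def)
  have "finite I" by (simp add: I_def)
  from ex_bij_betw_nat_finite[OF this] obtain h where h: "bij_betw h {0..<k} I" by (auto simp: k_def)
  have hI: "h j < n" "s (h j) \<noteq> 0" "0 \<le> s (h j)" if "j < k" for j
    using bij_betwE[OF h] that s(1) by (auto simp: I_def)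
  have hinj: "h i = h j \<longleftrightarrow> i = j" if "i < k" "j < k" for i j
    using bij_betw_imp_inj_on[OF h] that by (auto simp: inj_on_def)
  \<comment> \<open>R selects, scales and pads at once. \<open>R * R\<^sup>T\<close> is the full
    diagonal of s, which reproduces X, while \<open>R\<^sup>T * R\<close> is the padded diagonal of
    t, which will be the Gram matrix of both factors.\<close>
  define R where "R = Matrix.mat n d (\<lambda>(i, j). if j < k \<and> h j = i then sqrt (s i) else 0)"
  define t where "t j = (if j < k then s (h j) else 0)" for j
  have R: "R \<in> carrier_mat n d" by (simp add: R_def)
  have "R * R\<^sup>T = mat_diag n s"
  proof (rule eq_matI)
    fix i j assume "i < dim_row (mat_diag n s)" "j < dim_col (mat_diag n s)"
    then have ij: "i < n" "j < n" by (auto simp: mat_diag_def)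
    have "(R * R\<^sup>T) $$ (i, j) = (\<Sum>l<d. (if l < k \<and> h l = i then sqrt (s i) else 0) * (if l < k \<and> h l = j then sqrt (s j) else 0))"
      using ij by (simp add: R_def scalar_prod_def lessThan_atLeast0)
    also have "\<dots> = (\<Sum>l<d. if l < k \<and> h l = i then (if i = j then s i else 0) else 0)"
      using s(1)[OF ij(1)] by (intro sum.cong) auto
    also have "\<dots> = (if i = j then s i else 0)"
    proof (cases "s i = 0")
      case False
      then have "i \<in> h ` {0..<k}" using ij bij_betw_imp_surj_on[OF h] by (auto simp: I_def)
      then obtain l0 where l0: "l0 < k" "h l0 = i" by auto
      have "(\<Sum>l<d. if l < k \<and> h l = i then (if i = j then s i else 0) else 0)
        = (\<Sum>l<d. if l = l0 then (if i = j then s i else 0) else 0)"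
        using l0 hinj by (intro sum.cong) auto
      also have "\<dots> = (if i = j then s i else 0)" using l0 k by simp
      finally show ?thesis .
    qed (auto intro!: sum.neutral)
    finally show "(R * R\<^sup>T) $$ (i, j) = mat_diag n s $$ (i, j)" using ij by (simp add: mat_diag_def)
  qed (auto simp: R_def mat_diag_def)
  note RRT = this
  have RTR: "R\<^sup>T * R = mat_diag d t"
  proof (rule eq_matI)
    fix i j assume "i < dim_row (mat_diag d t)" "j < dim_col (mat_diag d t)"
    then have ij: "i < d" "j < d" by (auto simp: mat_diag_def)
    have "(R\<^sup>T * R) $$ (i, j) = (\<Sum>l<n. (if i < k \<and> h i = l then sqrt (s l) else 0) * (if j < k \<and> h j = l then sqrt (s l) else 0))"
      using ij by (simp add: R_def scalar_prod_def lessThan_atLeast0)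
    also have "\<dots> = (\<Sum>l<n. if l = h i then (if i < k \<and> i = j then s (h i) else 0) else 0)"
      using hinj hI by (intro sum.cong) auto
    also have "\<dots> = mat_diag d t $$ (i, j)" using ij hI by (auto simp: mat_diag_def t_def)
    finally show "(R\<^sup>T * R) $$ (i, j) = mat_diag d t $$ (i, j)" .
  qed (auto simp: R_def mat_diag_def)
  have "mset (map t [0..<d]) = mset (map t [0..<k]) + mset (map t [k..<d])"
    using upt_add_eq_append[of 0 k "d - k"] k by simp
  then have "(\<Sum>x\<in>#mset (map t [0..<d]). x powr p) = (\<Sum>j<k. t j powr p) + (\<Sum>j\<in>{k..<d}. t j powr p)"
    by (simp add: sum_unfold_sum_mset image_mset.compositionality o_def lessThan_atLeast0 mset_upt)
  \<comment> \<open>The padding contributes nothing because 0 powr p = 0.\<close>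
  also have "\<dots> = (\<Sum>j<k. s (h j) powr p)" by (simp add: t_def)
  also have "\<dots> = (\<Sum>i\<in>I. s i powr p)"
    using sum.reindex_bij_betw[OF h, of "\<lambda>i. s i powr p"] by (simp add: lessThan_atLeast0)
  also have "\<dots> = (\<Sum>i<n. s i powr p)" by (rule sum.mono_neutral_left) (auto simp: I_def)
  also have "\<dots> = (\<Sum>x\<in>#singular_values_mset X. x powr p)"
    unfolding s(2) by (simp add: sum_unfold_sum_mset image_mset.compositionality o_def lessThan_atLeast0 mset_upt)
  finally have sum: "(\<Sum>x\<in>#proots (char_poly (mat_diag d t)). x powr p) = (\<Sum>x\<in>#singular_values_mset X. x powr p)"
    by (simp only: proots_char_poly_mat_diag)
  define U where "U = A * R"
  define V where "V = Q * R"
  have UV: "U \<in> carrier_mat m d" "V \<in> carrier_mat n d" using Ac Q(1) R by (auto simp: U_def V_def)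
  have "U * V\<^sup>T = A * (R * R\<^sup>T) * Q\<^sup>T"
    using Ac Q(1) R by (simp add: U_def V_def transpose_mult[of _ n n _ d] assoc_mult_mat[of _ m n _ d _ n]
      assoc_mult_mat[of _ n d _ n _ n] assoc_mult_mat[of _ m n _ n _ n])
  then have X': "X = U * V\<^sup>T" using A(2) by (simp only: RRT)
  have gram: "(W * R)\<^sup>T * (W * R) = R\<^sup>T * ((W\<^sup>T * W) * R)" if "W \<in> carrier_mat l n" for W l
    using that R by (simp add: transpose_mult[of _ l n _ d] assoc_mult_mat[of _ d n _ l _ d] assoc_mult_mat[of _ n l _ n _ d])
  \<comment> \<open>The 0/1 diagonal \<open>A\<^sup>T * A\<close> acts as the identity here, since
    the rows of R it would erase, those with s i = 0, are zero.\<close>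
  have "(A\<^sup>T * A) * R = R"
    unfolding A(3) mat_diag_mult_left[OF R] by (rule eq_matI) (auto simp: R_def)
  then have "U\<^sup>T * U = mat_diag d t" using gram[OF Ac] RTR by (simp add: U_def)
  moreover have "V\<^sup>T * V = mat_diag d t" using gram[OF Q(1)] RTR R by (simp add: V_def Q(2))
  ultimately show ?thesis using that[OF UV X'] sum by simp
qed

text \<open>Each attained minimum is expressed as a lower bound over all factorizations together
  with a factorization that reaches it.\<close>

theorem theorem2:
  fixes p :: real and m n d r :: nat and X :: "real mat"
  assumes "0 < p" and "p \<le> 1"
    and "X \<in> carrier_mat m n"
    and "vec_space.rank m X = r" and "r \<le> d"
  shows
    "(\<forall>U V. U \<in> carrier_mat m d \<longrightarrow> V \<in> carrier_mat n d \<longrightarrow> X = U * transpose_mat V \<longrightarrow>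
         schatten p X \<le> schatten (2 * p) U * schatten (2 * p) V)
   \<and> (\<exists>U V. U \<in> carrier_mat m d \<and> V \<in> carrier_mat n d \<and> X = U * transpose_mat V \<and>
         schatten p X = schatten (2 * p) U * schatten (2 * p) V)
   \<and> (\<forall>U V. U \<in> carrier_mat m d \<longrightarrow> V \<in> carrier_mat n d \<longrightarrow> X = U * transpose_mat V \<longrightarrow>
         schatten p X \<le> ((schatten (2 * p) U powr (2 * p) + schatten (2 * p) V powr (2 * p)) / 2) powr (1 / p))
   \<and> (\<exists>U V. U \<in> carrier_mat m d \<and> V \<in> carrier_mat n d \<and> X = U * transpose_mat V \<and>
         schatten p X = ((schatten (2 * p) U powr (2 * p) + schatten (2 * p) V powr (2 * p)) / 2) powr (1 / p))"
proof -
  note p = assms(1,2)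
  have le: "schatten p X \<le> schatten (2 * p) U * schatten (2 * p) V"
    if "U \<in> carrier_mat m d" "V \<in> carrier_mat n d" "X = U * V\<^sup>T" for U V
    using schatten_mult_le[OF p that] .
  have am_gm: "schatten (2 * p) U * schatten (2 * p) V
      \<le> ((schatten (2 * p) U powr (2 * p) + schatten (2 * p) V powr (2 * p)) / 2) powr (1 / p)" for U V
  proof -
    let ?a = "schatten (2 * p) U powr (2 * p)" and ?b = "schatten (2 * p) V powr (2 * p)"
    have "schatten (2 * p) U * schatten (2 * p) V = sqrt (?a * ?b) powr (1 / p)"
      by (rule schatten_mult_eq_powr[OF p(1)])
    also have "\<dots> \<le> ((?a + ?b) / 2) powr (1 / p)"
      using p arith_geo_mean_sqrt[of ?a ?b] by (intro powr_mono2) auto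
    finally show ?thesis .
  qed
  obtain U V where UV: "U \<in> carrier_mat m d" "V \<in> carrier_mat n d" "X = U * V\<^sup>T"
    and sums: "(\<Sum>x\<in>#proots (char_poly (U\<^sup>T * U)). x powr p) = (\<Sum>x\<in>#singular_values_mset X. x powr p)"
      "(\<Sum>x\<in>#proots (char_poly (V\<^sup>T * V)). x powr p) = (\<Sum>x\<in>#singular_values_mset X. x powr p)"
    using balanced_factorization[OF assms(3), of d p] assms(4,5) by metis
  have "((schatten (2 * p) U powr (2 * p) + schatten (2 * p) V powr (2 * p)) / 2) powr (1 / p) = schatten p X"
  proof -
    have "(x + x) / 2 = x" for x :: real by simp
    then show ?thesis
      unfolding schatten_powr_eq[OF UV(1) p(1)] schatten_powr_eq[OF UV(2) p(1)] sums
      by (simp only: schatten_def)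
  qed
  \<comment> \<open>For the balanced pair the arithmetic mean expression equals
    \<open>schatten p X\<close>; the product lies between the two by \<open>le\<close> and
    \<open>am_gm\<close>, so all three coincide.\<close>
  then have attained: "schatten p X = schatten (2 * p) U * schatten (2 * p) V
    \<and> schatten p X = ((schatten (2 * p) U powr (2 * p) + schatten (2 * p) V powr (2 * p)) / 2) powr (1 / p)"
    using le[OF UV] am_gm[of U V] by simp
  show ?thesis
    by (intro conjI allI impI) (use UV attained le order_trans[OF le am_gm] in blast)+
qed

end
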